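(* There exist absolute constants $c, C > 0$ such that for all integers $k > s \geq 3$ and every sufficiently large integer $n$ (in terms of $k$ and $s$), $$\left(\frac{c \cdot r_k(n)}{n}\right)^{2(s-2)} n^2 \;\leq\; f_{s,k}(n) \;\leq\; \left(\frac{r_k(n)}{n}\right)^{C} n^2.$$
   Context: A $k$-term arithmetic progression is a set of the form $\{x, x+d, \dots, x+(k-1)d\}$ of integers with common difference $d \neq 0$. A set of integers is $k$-AP free if it contains no such progression. $r_k(n)$ denotes the maximum size of a $k$-AP free subset of $\{1,\dots,n\}$. For a finite set $A$ of integers, $f_s(A)$ denotes the number of $s$-term arithmetic progressions contained in $A$. For integers $k > s \geq 3$ and $n\ge 1$, $f_{s,k}(n)$ is the maximum of $f_s(A)$ over all sets $A$ of $n$ nonnegative integers that are $k$-AP free. *)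

theory Defs
  imports Complex_Main
begin

text \<open>
  Progressions are sets, so a common difference and its negative give the same progression,
  which is counted once.
\<close>

definition is_AP :: "nat \<Rightarrow> int set \<Rightarrow> bool" where
  "is_AP k P \<longleftrightarrow> (\<exists>x d. d \<noteq> 0 \<and> P = (\<lambda>i. x + int i * d) ` {..<k})"

definition AP_free :: "nat \<Rightarrow> int set \<Rightarrow> bool" where
  "AP_free k A \<longleftrightarrow> \<not> (\<exists>P. is_AP k P \<and> P \<subseteq> A)"

definition r_AP :: "nat \<Rightarrow> nat \<Rightarrow> nat" where
  "r_AP k n = Max {card A |A. A \<subseteq> {1..int n} \<and> AP_free k A}"

definition AP_count :: "nat \<Rightarrow> int set \<Rightarrow> nat" where
  "AP_count s A = card {P. is_AP s P \<and> P \<subseteq> A}"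

text \<open>
  The set below is finite, since \<^term>\<open>AP_count s A \<le> 2 ^ card A\<close> for finite \<^term>\<open>A\<close>, and for
  \<^term>\<open>k \<ge> 3\<close> it is nonempty (take the first \<^term>\<open>n\<close> powers of two), so \<^const>\<open>Max\<close> is a
  genuine maximum.
\<close>

definition max_AP_count :: "nat \<Rightarrow> nat \<Rightarrow> nat \<Rightarrow> nat" where
  "max_AP_count s k n =
     Max {AP_count s A |A. A \<subseteq> {0..} \<and> finite A \<and> card A = n \<and> AP_free k A}"

end

theory Submission
  imports Defs "HOL-Library.Set_Algebras" "HOL-Library.FuncSet" "HOL-Computational_Algebra.Primes"
begin

text \<open>
  Upper bound. Suppose \<open>A\<close> has \<open>n\<close> elements and \<open>\<epsilon> n\<^sup>2\<close> progressions. Joining \<open>x\<close> to \<open>z\<close> when their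
  midpoint lies in \<open>A\<close> gives a dense graph along whose edges only \<open>n\<close> sums occur. The
  Balog-Szemeredi-Gowers argument yields large \<open>A', B' \<subseteq> A\<close> with \<open>A' + B'\<close> small, so \<open>2B' - 2B'\<close> is
  small by Petridis' lemma and Ruzsa's triangle inequality. Ruzsa's model lemma then maps half of \<open>B'\<close>
  into an interval of comparable length without creating progressions, whence
  \<open>r_k(n)/n\<close> is at least a constant times \<open>\<epsilon>\<^bsup>25\<^esup>\<close>. As \<open>\<epsilon> \<le> 1/2\<close>, the constant is absorbed
  into the exponent and Szemeredi's theorem is not needed.

  Lower bound. Put translates \<open>S + t i\<close> (\<open>i < s\<close>) of an extremal set \<open>S \<subseteq> {1..m}\<close>, \<open>m = n div s\<close>, into
  \<open>s\<close> far apart equidistant windows. A progression with \<open>k > s\<close> terms projects to a constant window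
  index, hence lies in a translate of \<open>S\<close>; averaging over the \<open>t i\<close> gives many \<open>s\<close>-term progressions
  across the windows. Taking about \<open>n / card S\<close> copies very far apart gives order
  \<open>(r_k(n)/n)\<^bsup>s-1\<^esup> n\<^sup>2\<close>, and \<open>s - 1 \<le> 2(s - 2)\<close>.
\<close>

subsection \<open>Paths of length three in dense bipartite graphs\<close>

lemma sum_card_swap:
  assumes "finite X" "finite Y"
  shows "(\<Sum>x\<in>X. card {y \<in> Y. R x y}) = (\<Sum>y\<in>Y. card {x \<in> X. R x y})"
proof -
  have "(\<Sum>x\<in>X. card {y \<in> Y. R x y}) = (\<Sum>x\<in>X. \<Sum>y\<in>Y. if R x y then 1 else 0)"
    using assms by (simp add: sum.If_cases Int_def)
  also have "\<dots> = (\<Sum>y\<in>Y. \<Sum>x\<in>X. if R x y then 1 else 0)"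
    by (rule sum.swap)
  also have "\<dots> = (\<Sum>y\<in>Y. card {x \<in> X. R x y})"
    using assms by (simp add: sum.If_cases Int_def)
  finally show ?thesis .
qed

lemma sum_card_swap_real:
  assumes "finite X" "finite Y"
  shows "(\<Sum>x\<in>X. real (card {y \<in> Y. R x y})) = (\<Sum>y\<in>Y. real (card {x \<in> X. R x y}))"
  using sum_card_swap[OF assms, of R] by (simp flip: of_nat_sum)

text \<open>Dependent random choice: \<open>A'\<close> lives in the neighbourhood \<open>V\<close> of a vertex \<open>y0\<close> chosen so that \<open>V\<close> is
  large and few pairs in it have small codegree.\<close>

lemma dense_bipartite_many_paths:
  fixes E :: "('a \<times> 'b) set" and \<epsilon> :: real
  assumes fin: "finite A" "finite B" and card: "card A = n" "card B = n"
    and E: "E \<subseteq> A \<times> B" "\<epsilon> * real n ^ 2 \<le> real (card E)" and pos: "\<epsilon> > 0" "n > 0"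
  obtains A' B' where "A' \<subseteq> A" "B' \<subseteq> B"
    "\<epsilon> * n / 6 \<le> card A'" "\<epsilon> * n / 4 \<le> card B'"
    "\<And>a b. a \<in> A' \<Longrightarrow> b \<in> B' \<Longrightarrow>
       \<epsilon> ^ 5 * real n ^ 2 / 3072 \<le> card {(b', a'). (a, b') \<in> E \<and> (a', b') \<in> E \<and> (a', b) \<in> E}"
proof -
  define deg where "deg x = card {y \<in> B. (x, y) \<in> E}" for x
  define codeg where "codeg x x' = card {y \<in> B. (x, y) \<in> E \<and> (x', y) \<in> E}" for x x'
  \<comment> \<open>Vertices of degree below \<open>\<epsilon> * n / 2\<close> are dropped; together
    they carry at most half of the guaranteed edges.\<close>
  define X where "X = {x \<in> A. \<epsilon> * n / 2 \<le> deg x}"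
  define U where "U y = {x \<in> X. (x, y) \<in> E}" for y
  \<comment> \<open>Both constants serve later halvings: \<open>2 * \<eta> * u\<close> is half of
    the threshold \<open>\<epsilon> * u / 4\<close> in \<open>B'\<close>, and
    \<open>\<zeta> / \<eta> = \<epsilon>^2 / 8\<close> is half of the coefficient in
    \<open>sumU2\<close>.\<close>
  define \<eta> where "\<eta> = \<epsilon> / 16"
  define \<zeta> where "\<zeta> = \<eta> * \<epsilon>\<^sup>2 / 8"
  define bad where "bad x x' \<longleftrightarrow> codeg x x' < \<zeta> * n" for x x'
  define Bd where "Bd = {p \<in> X \<times> X. bad (fst p) (snd p)}"
  define w where "w y = card {p \<in> Bd. (fst p, y) \<in> E \<and> (snd p, y) \<in> E}" for y
  have \<eta>\<zeta>: "\<eta> > 0" "\<zeta> > 0" using pos by (auto simp: \<eta>_def \<zeta>_def)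
  have XA: "X \<subseteq> A" by (auto simp: X_def)
  have finX: "finite X" using XA fin finite_subset by blast
  have cX: "card X \<le> n" using XA fin card card_mono by blast
  have finBd: "finite Bd" unfolding Bd_def using finX by simp
  have cBd: "card Bd \<le> n\<^sup>2"
  proof -
    have "card Bd \<le> card (X \<times> X)" unfolding Bd_def by (rule card_mono) (use finX in auto)
    also have "\<dots> \<le> n\<^sup>2" using mult_mono[OF cX cX] by (simp add: card_cartesian_product power2_eq_square)
    finally show ?thesis .
  qed
  have "E = Sigma A (\<lambda>x. {y \<in> B. (x, y) \<in> E})" using E(1) by auto
  then have "card E = card (Sigma A (\<lambda>x. {y \<in> B. (x, y) \<in> E}))" by (rule arg_cong)
  also have "\<dots> = (\<Sum>x\<in>A. deg x)" unfolding deg_def using fin by (intro card_SigmaI) auto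
  finally have "real (card E) = (\<Sum>x\<in>A. real (deg x))" by simp
  moreover have "(\<Sum>x\<in>A. real (deg x)) = (\<Sum>x\<in>X. real (deg x)) + (\<Sum>x\<in>A - X. real (deg x))"
    using sum.subset_diff[OF XA fin(1)] by (simp add: add.commute)
  moreover have "(\<Sum>x\<in>A - X. real (deg x)) \<le> (\<Sum>x\<in>A. \<epsilon> * n / 2)"
  proof -
    have "(\<Sum>x\<in>A - X. real (deg x)) \<le> (\<Sum>x\<in>A-X. \<epsilon> * n / 2)"
      by (rule sum_mono) (auto simp: X_def)
    also have "\<dots> \<le> (\<Sum>x\<in>A. \<epsilon> * n / 2)" by (rule sum_mono2) (use fin pos in auto)
    finally show ?thesis .
  qed
  ultimately have "(\<Sum>x\<in>X. real (deg x)) \<ge> \<epsilon> * n\<^sup>2 / 2"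
    using E(2) card by (simp add: power2_eq_square mult_ac)
  moreover have "(\<Sum>x\<in>X. real (deg x)) = (\<Sum>y\<in>B. real (card (U y)))"
    unfolding deg_def U_def by (rule sum_card_swap_real) (use finX fin in auto)
  ultimately have sumU: "(\<Sum>y\<in>B. real (card (U y))) \<ge> \<epsilon> * n\<^sup>2 / 2" by simp
  have sumU2: "(\<Sum>y\<in>B. (real (card (U y)))\<^sup>2) \<ge> \<epsilon>\<^sup>2 * n^3 / 4"
  proof -
    \<comment> \<open>Cauchy-Schwarz in tangent form: \<open>2 * t * x - t^2 \<le> x^2\<close> is
      summed with \<open>t\<close> the lower bound for the mean of
      \<open>card (U y)\<close>.\<close>
    define t where "t = \<epsilon> * n / 2"
    have t: "t > 0" using pos by (simp add: t_def)
    have "(\<Sum>y\<in>B. 2 * t * card (U y) - t\<^sup>2) \<le> (\<Sum>y\<in>B. (real (card (U y)))\<^sup>2)"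
    proof (rule sum_mono)
      fix y
      have "0 \<le> (real (card (U y)) - t)\<^sup>2" by simp
      then show "2 * t * card (U y) - t\<^sup>2 \<le> (real (card (U y)))\<^sup>2" by (simp add: power2_diff mult_ac)
    qed
    moreover have "(\<Sum>y\<in>B. 2 * t * card (U y) - t\<^sup>2) = 2 * t * (\<Sum>y\<in>B. real (card (U y))) - n * t\<^sup>2"
      using card by (simp add: sum_subtractf sum_distrib_left)
    moreover have "2 * t * (\<Sum>y\<in>B. real (card (U y))) \<ge> 2 * t * (\<epsilon> * n\<^sup>2 / 2)"
      using sumU t by (intro mult_left_mono) auto
    moreover have "2 * t * (\<epsilon> * n\<^sup>2 / 2) - n * t\<^sup>2 = \<epsilon>\<^sup>2 * n^3 / 4"
      by (simp add: t_def power2_eq_square power3_eq_cube field_simps)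
    ultimately show ?thesis by linarith
  qed
  have sumw: "(\<Sum>y\<in>B. real (w y)) \<le> \<zeta> * n^3"
  proof -
    have "(\<Sum>y\<in>B. real (w y)) = (\<Sum>p\<in>Bd. real (codeg (fst p) (snd p)))"
      unfolding w_def codeg_def by (rule sum_card_swap_real[symmetric]) (use finBd fin in auto)
    also have "\<dots> \<le> (\<Sum>p\<in>Bd. \<zeta> * n)"
      by (rule sum_mono) (auto simp: Bd_def bad_def)
    also have "\<dots> = card Bd * (\<zeta> * n)" by simp
    also have "\<dots> \<le> real (n\<^sup>2) * (\<zeta> * n)"
      using cBd \<eta>\<zeta> by (intro mult_right_mono) (auto simp flip: of_nat_power)
    finally show ?thesis by (simp add: power2_eq_square power3_eq_cube mult_ac)
  qed
  \<comment> \<open>The mean over \<open>y\<close> of this penalised square is at least the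
    right-hand side. A vertex attaining it has a large \<open>U y\<close>, in which bad pairs number
    at most \<open>\<eta>\<close> times the square of its size.\<close>
  have "\<exists>y\<in>B. (real (card (U y)))\<^sup>2 - w y / \<eta> \<ge> \<epsilon>\<^sup>2 * n\<^sup>2 / 8"
  proof (rule ccontr)
    assume "\<not> ?thesis"
    then have "(\<Sum>y\<in>B. (real (card (U y)))\<^sup>2 - w y / \<eta>) < (\<Sum>y\<in>B. \<epsilon>\<^sup>2 * n\<^sup>2 / 8)"
      by (intro sum_strict_mono) (use fin card pos in auto)
    also have "\<dots> = \<epsilon>\<^sup>2 * n^3 / 8" using card by (simp add: power2_eq_square power3_eq_cube)
    finally have "(\<Sum>y\<in>B. (real (card (U y)))\<^sup>2) - (\<Sum>y\<in>B. real (w y)) / \<eta> < \<epsilon>\<^sup>2 * n^3 / 8"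
      by (simp add: sum_subtractf sum_divide_distrib)
    moreover have "(\<Sum>y\<in>B. real (w y)) / \<eta> \<le> \<epsilon>\<^sup>2 * n^3 / 8"
      using sumw \<eta>\<zeta> by (simp add: \<zeta>_def field_simps)
    ultimately show False using sumU2 by linarith
  qed
  then obtain y0 where y0: "y0 \<in> B" "(real (card (U y0)))\<^sup>2 - w y0 / \<eta> \<ge> \<epsilon>\<^sup>2 * n\<^sup>2 / 8" by blast
  define V where "V = U y0"
  define u where "u = real (card V)"
  have VX: "V \<subseteq> X" by (auto simp: V_def U_def)
  have finV: "finite V" using VX finX finite_subset by blast
  have "w y0 / \<eta> \<ge> 0" using \<eta>\<zeta> by simp
  moreover have "(\<epsilon> * n / 3)\<^sup>2 \<le> \<epsilon>\<^sup>2 * n\<^sup>2 / 8"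
    by (simp add: power_divide power_mult_distrib)
  ultimately have "(\<epsilon> * n / 3)\<^sup>2 \<le> u\<^sup>2"
    using y0(2) unfolding u_def V_def by linarith
  then have u: "u \<ge> \<epsilon> * n / 3"
    by (rule power2_le_imp_le) (simp add: u_def)
  have "\<epsilon> * n / 3 > 0" using pos by simp
  then have upos: "u > 0" using u by linarith
  have "\<epsilon>\<^sup>2 * n\<^sup>2 / 8 \<ge> 0" by simp
  then have "w y0 / \<eta> \<le> u\<^sup>2" using y0(2) unfolding u_def V_def by linarith
  then have wu: "w y0 \<le> \<eta> * u\<^sup>2" using \<eta>\<zeta> by (simp add: field_simps)
  \<comment> \<open>Markov: a vertex of \<open>V\<close> has on average at most
    \<open>\<eta> * u\<close> bad partners, so at most half of \<open>V\<close> exceeds twice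
    that.\<close>
  define A' where "A' = {a \<in> V. card {x \<in> V. bad a x} \<le> 2 * \<eta> * u}"
  define B' where "B' = {b \<in> B. \<epsilon> * u / 4 \<le> card {x \<in> V. (x, b) \<in> E}}"
  have A'V: "A' \<subseteq> V" by (auto simp: A'_def)
  have "real (card (V - A')) * (2 * \<eta> * u) \<le> \<eta> * u\<^sup>2"
  proof -
    have "real (card (V - A')) * (2 * \<eta> * u) = (\<Sum>a\<in>V - A'. 2 * \<eta> * u)" by simp
    also have "\<dots> \<le> (\<Sum>a\<in>V - A'. real (card {x \<in> V. bad a x}))"
      by (rule sum_mono) (auto simp: A'_def)
    also have "\<dots> \<le> (\<Sum>a\<in>V. real (card {x \<in> V. bad a x}))"
      by (rule sum_mono2) (use finV in auto)
    also have "\<dots> = real (card (Sigma V (\<lambda>a. {x \<in> V. bad a x})))"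
      using finV by simp
    also have "\<dots> \<le> w y0"
      unfolding w_def of_nat_le_iff
      by (rule card_mono) (use finX VX in \<open>auto simp: Bd_def V_def U_def\<close>)
    finally show ?thesis using wu by linarith
  qed
  then have "real (card (V - A')) \<le> u / 2"
    using \<eta>\<zeta> upos by (simp add: power2_eq_square field_simps)
  moreover have "real (card V) = card A' + card (V - A')"
    using A'V finV by (simp add: card_Diff_subset card_mono finite_subset)
  ultimately have cA': "card A' \<ge> \<epsilon> * n / 6" using u by (simp add: u_def)
  have cB': "card B' \<ge> \<epsilon> * n / 4"
  proof -
    \<comment> \<open>Edges between \<open>V\<close> and \<open>B\<close> are counted from both
      sides; the vertices outside \<open>B'\<close> absorb at most half of them.\<close>
    have "u * (\<epsilon> * n / 2) = (\<Sum>x\<in>V. \<epsilon> * n / 2)" by (simp add: u_def)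
    also have "\<dots> \<le> (\<Sum>x\<in>V. real (deg x))" by (rule sum_mono) (use VX in \<open>auto simp: X_def\<close>)
    also have "\<dots> = (\<Sum>b\<in>B. real (card {x \<in> V. (x, b) \<in> E}))"
      unfolding deg_def by (rule sum_card_swap_real) (use finV fin in auto)
    also have "\<dots> \<le> (\<Sum>b\<in>B. (if b \<in> B' then u else 0) + \<epsilon> * u / 4)"
    proof (rule sum_mono)
      fix b assume "b \<in> B"
      have "real (card {x \<in> V. (x, b) \<in> E}) \<le> u" unfolding u_def
        using finV by (auto intro!: card_mono)
      moreover have "\<epsilon> * u / 4 \<ge> 0" using pos upos by simp
      ultimately show "real (card {x \<in> V. (x, b) \<in> E}) \<le> (if b \<in> B' then u else 0) + \<epsilon> * u / 4"
        using \<open>b \<in> B\<close> by (auto simp: B'_def)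
    qed
    also have "\<dots> = card B' * u + n * (\<epsilon> * u / 4)"
    proof -
      have "B \<inter> B' = B'" by (auto simp: B'_def)
      then show ?thesis using fin card by (simp add: sum.distrib sum.If_cases)
    qed
    finally have "u * (\<epsilon> * n / 4) \<le> u * card B'" by (simp add: field_simps)
    then show ?thesis using upos by simp
  qed
  show thesis
  proof (rule that[OF _ _ cA' cB'])
    show "A' \<subseteq> A" using A'V VX XA by blast
    show "B' \<subseteq> B" by (auto simp: B'_def)
    fix a b assume a: "a \<in> A'" and b: "b \<in> B'"
    \<comment> \<open>The candidates for \<open>a'\<close>: neighbours of \<open>b\<close> whose
      codegree with \<open>a\<close> is at least \<open>\<zeta> * n\<close>, which is the number of
      choices for \<open>b'\<close>. With \<open>u \<ge> \<epsilon> * n / 3\<close> the constant is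
      3 * 8 * 128 = 3072.\<close>
    define G where "G = {x \<in> V. (x, b) \<in> E} - {x \<in> V. bad a x}"
    have "real (card G) \<ge> real (card {x \<in> V. (x, b) \<in> E}) - card {x \<in> V. bad a x}"
    proof -
      have "card {x \<in> V. (x, b) \<in> E} - card {x \<in> V. bad a x} \<le> card G"
        unfolding G_def by (rule diff_card_le_card_Diff) (use finV in auto)
      then show ?thesis by linarith
    qed
    moreover have "real (card {x \<in> V. (x, b) \<in> E}) \<ge> \<epsilon> * u / 4" using b by (auto simp: B'_def)
    moreover have "card {x \<in> V. bad a x} \<le> \<epsilon> * u / 8" using a by (auto simp: A'_def \<eta>_def)
    ultimately have G: "card G \<ge> \<epsilon> * u / 8" by linarith
    have finG: "finite G" using finV by (simp add: G_def)
    let ?P = "{(b', a'). (a, b') \<in> E \<and> (a', b') \<in> E \<and> (a', b) \<in> E}"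
    have finP: "finite ?P"
      by (rule finite_subset[of _ "B \<times> A"]) (use E(1) fin in auto)
    have "(\<epsilon> * (\<epsilon> * n / 3) / 8) * (\<zeta> * n) \<le> (\<epsilon> * u / 8) * (\<zeta> * n)"
      using u pos \<eta>\<zeta> by (intro mult_right_mono divide_right_mono mult_left_mono) auto
    also have "\<dots> \<le> card G * (\<zeta> * n)" using G \<eta>\<zeta> by (intro mult_right_mono) auto
    also have "\<dots> = (\<Sum>x\<in>G. \<zeta> * n)" by simp
    also have "\<dots> \<le> (\<Sum>x\<in>G. real (codeg a x))"
      by (rule sum_mono) (auto simp: G_def bad_def)
    also have "\<dots> = real (card (Sigma G (\<lambda>x. {y \<in> B. (a, y) \<in> E \<and> (x, y) \<in> E})))"
      using finG fin by (simp add: codeg_def)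
    also have "\<dots> \<le> card (prod.swap ` ?P)"
      unfolding of_nat_le_iff
      by (rule card_mono) (use finP in \<open>auto simp: G_def image_iff\<close>)
    also have "\<dots> = card ?P" by (simp add: card_image)
    finally show "\<epsilon> ^ 5 * real n ^ 2 / 3072 \<le> card ?P"
      by (simp add: \<zeta>_def \<eta>_def power2_eq_square eval_nat_numeral mult_ac)
  qed
qed

subsection \<open>Sumset inequalities\<close>

text \<open>One representation \<open>d = u - v\<close> is fixed for each difference. The pair
  \<open>(x + u, x + v)\<close> gives back \<open>d\<close> by subtraction and then
  \<open>x\<close>, so the map on pairs \<open>(x, d)\<close> is injective.\<close>

lemma Ruzsa_triangle:
  fixes X U V :: "'a::ab_group_add set"
  assumes "finite X" "finite U" "finite V"
  shows "card X * card ((\<lambda>(u, v). u - v) ` (U \<times> V)) \<le> card (X + U) * card (X + V)"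
proof -
  let ?D = "(\<lambda>(u, v). u - v) ` (U \<times> V)"
  have "\<forall>d\<in>?D. \<exists>u v. u \<in> U \<and> v \<in> V \<and> d = u - v" by auto
  then obtain f g where fg: "\<And>d. d \<in> ?D \<Longrightarrow> f d \<in> U \<and> g d \<in> V \<and> d = f d - g d"
    by metis
  have "card (X \<times> ?D) \<le> card ((X + U) \<times> (X + V))"
  proof (rule card_inj_on_le[where f = "\<lambda>(x, d). (x + f d, x + g d)"])
    show "inj_on (\<lambda>(x, d). (x + f d, x + g d)) (X \<times> ?D)"
    proof (rule inj_onI)
      fix p q assume "p \<in> X \<times> ?D" "q \<in> X \<times> ?D"
        and *: "(\<lambda>(x, d). (x + f d, x + g d)) p = (\<lambda>(x, d). (x + f d, x + g d)) q"
      then obtain x d x' d' where p: "p = (x, d)" "q = (x', d')" and d: "d \<in> ?D" and d': "d' \<in> ?D"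
        by (metis mem_Sigma_iff surj_pair)
      have eq: "x + f d = x' + f d'" "x + g d = x' + g d'" using * p by simp_all
      have "d = (x + f d) - (x + g d)" using fg[OF d] by simp
      also have "\<dots> = (x' + f d') - (x' + g d')" by (simp only: eq)
      also have "\<dots> = d'" using fg[OF d'] by simp
      finally show "p = q" using eq p by simp
    qed
    show "(\<lambda>(x, d). (x + f d, x + g d)) ` (X \<times> ?D) \<subseteq> (X + U) \<times> (X + V)"
      using fg by (auto intro!: set_plus_intro)
    show "finite ((X + U) \<times> (X + V))" using assms by (simp add: finite_set_plus)
  qed
  then show ?thesis by (simp add: card_cartesian_product)
qed

lemma card_translate:
  fixes X :: "'a::ab_group_add set"
  shows "card ((\<lambda>x. x + c) ` X) = card X"
  by (rule card_image) (auto intro: inj_onI)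

lemma Petridis:
  fixes A B :: "'a::ab_group_add set"
  assumes A: "finite A" "A \<noteq> {}" and B: "finite B"
  obtains X where "X \<subseteq> A" "X \<noteq> {}"
    "\<And>C. finite C \<Longrightarrow> card (X + B + C) \<le> card (A + B) / card A * card (X + C)"
proof -
  \<comment> \<open>a subset minimising the ratio works for every \<open>C\<close> at once, by induction on \<open>C\<close>\<close>
  define ratio where "ratio X = real (card (X + B)) / card X" for X
  obtain X where "is_arg_min ratio (\<lambda>X. X \<in> Pow A - {{}}) X"
    using ex_is_arg_min_if_finite[of "Pow A - {{}}" ratio] A by blast
  then have X: "X \<subseteq> A" "X \<noteq> {}" and min: "\<And>Y. Y \<subseteq> A \<Longrightarrow> Y \<noteq> {} \<Longrightarrow> ratio X \<le> ratio Y"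
    by (auto simp: is_arg_min_linorder)
  define \<kappa> where "\<kappa> = ratio X"
  have finX: "finite X" using X A finite_subset by blast
  have \<kappa>0: "\<kappa> \<ge> 0" by (simp add: \<kappa>_def ratio_def)
  have minZ: "\<kappa> * card Z \<le> card (Z + B)" if "Z \<subseteq> X" for Z
  proof (cases "Z = {}")
    case False
    then have "card Z > 0" using that finX finite_subset by (metis card_gt_0_iff)
    moreover have "\<kappa> \<le> ratio Z" unfolding \<kappa>_def using min[of Z] that False X by blast
    ultimately show ?thesis by (simp add: ratio_def field_simps)
  qed simp
  have "card X > 0" using finX X by (simp add: card_gt_0_iff)
  then have XB: "card (X + B) = \<kappa> * card X" by (simp add: \<kappa>_def ratio_def)
  have main: "card (X + B + C) \<le> \<kappa> * card (X + C)" if "finite C" for C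
    using that
  proof (induction C)
    case empty
    have "X + B + {} = {}" "X + {} = {}" by (auto simp: set_plus_def)
    then show ?case by simp
  next
    case (insert c C)
    \<comment> \<open>For \<open>x\<close> in \<open>Z\<close> the translate of \<open>x + B\<close>
      by \<open>c\<close> contributes nothing new; for \<open>x\<close> in \<open>W\<close> already
      \<open>x + c\<close> is not new. By minimality the left side grows by at most
      \<open>\<kappa> * (card X - card Z)\<close>, while \<open>X + C\<close> grows by at least
      \<open>card X - card Z\<close> because \<open>W \<subseteq> Z\<close>.\<close>
    define Z where "Z = {x \<in> X. \<forall>b\<in>B. x + b + c \<in> X + B + C}"
    define W where "W = {x \<in> X. x + c \<in> X + C}"
    have WZ: "W \<subseteq> Z"
    proof
      fix x assume "x \<in> W"
      then obtain x' c' where *: "x \<in> X" "x' \<in> X" "c' \<in> C" "x + c = x' + c'"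
        by (auto simp: W_def set_plus_def)
      have "x + b + c \<in> X + B + C" if "b \<in> B" for b
      proof -
        have "x + b + c = (x' + b) + c'" using *(4) by (metis add.assoc add.commute)
        then show ?thesis using *(2,3) that by (metis set_plus_intro)
      qed
      then show "x \<in> Z" using * by (auto simp: Z_def)
    qed
    have ZX: "Z \<subseteq> X" by (auto simp: Z_def)
    have finZ: "finite Z" using ZX finX finite_subset by blast
    have fin: "finite (X + B)" "finite (Z + B)" "finite (X + B + C)" "finite (X + C)" "finite W"
      using finX finZ B insert.hyps WZ by (auto intro: finite_set_plus finite_subset)
    have ZB: "Z + B \<subseteq> X + B" using ZX by (rule set_plus_mono2) simp
    have "X + B + insert c C \<subseteq> (X + B + C) \<union> (\<lambda>s. s + c) ` (X + B - (Z + B))"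
    proof
      fix s assume "s \<in> X + B + insert c C"
      then obtain x b c' where s: "x \<in> X" "b \<in> B" "c' \<in> insert c C" "s = x + b + c'"
        by (auto simp: set_plus_def)
      show "s \<in> (X + B + C) \<union> (\<lambda>s. s + c) ` (X + B - (Z + B))"
      proof (cases "c' \<in> C")
        case True
        then show ?thesis using s by (blast intro: set_plus_intro)
      next
        case False
        then have c': "c' = c" using s by simp
        show ?thesis
        proof (cases "x + b \<in> Z + B")
          case True
          then obtain z b' where z: "z \<in> Z" "b' \<in> B" "x + b = z + b'" by (auto simp: set_plus_def)
          then have "z + b' + c \<in> X + B + C" by (auto simp: Z_def)
          then show ?thesis using z s c' by simp
        next
          case False
          then have "x + b \<in> X + B - (Z + B)" using s by (blast intro: set_plus_intro)
          then show ?thesis using s c' by blast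
        qed
      qed
    qed
    then have "card (X + B + insert c C) \<le> card ((X + B + C) \<union> (\<lambda>s. s + c) ` (X + B - (Z + B)))"
      by (rule card_mono[rotated]) (use fin in auto)
    also have "\<dots> \<le> card (X + B + C) + card ((\<lambda>s. s + c) ` (X + B - (Z + B)))" by (rule card_Un_le)
    also have "\<dots> = card (X + B + C) + (card (X + B) - card (Z + B))"
      using fin ZB by (simp add: card_translate card_Diff_subset)
    finally have 1: "real (card (X + B + insert c C)) \<le> card (X + B + C) + (card (X + B) - real (card (Z + B)))"
      using card_mono[OF fin(1) ZB] by linarith
    have "(X + C) \<union> (\<lambda>x. x + c) ` (X - W) \<subseteq> X + insert c C"
      by (auto intro!: set_plus_intro simp: set_plus_def)
    then have "card ((X + C) \<union> (\<lambda>x. x + c) ` (X - W)) \<le> card (X + insert c C)"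
      by (rule card_mono[rotated]) (use finX insert.hyps in \<open>auto intro!: finite_set_plus\<close>)
    moreover have "card ((X + C) \<union> (\<lambda>x. x + c) ` (X - W)) = card (X + C) + card ((\<lambda>x. x + c) ` (X - W))"
      by (rule card_Un_disjoint) (use fin finX in \<open>auto simp: W_def\<close>)
    moreover have "card ((\<lambda>x. x + c) ` (X - W)) = card X - card W"
      using fin WZ ZX by (simp add: card_translate card_Diff_subset)
    ultimately have "card (X + C) + (card X - card Z) \<le> card (X + insert c C)"
      using card_mono[OF finZ WZ] by linarith
    then have 2: "real (card (X + C)) + (real (card X) - card Z) \<le> card (X + insert c C)"
      using card_mono[OF finX ZX] by linarith
    have "real (card (X + B + insert c C)) \<le> \<kappa> * card (X + C) + (\<kappa> * card X - \<kappa> * card Z)"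
      using 1 insert.IH minZ[OF ZX] XB by linarith
    also have "\<dots> = \<kappa> * (card (X + C) + (real (card X) - card Z))" by (simp add: algebra_simps)
    also have "\<dots> \<le> \<kappa> * card (X + insert c C)" using 2 \<kappa>0 by (rule mult_left_mono)
    finally show ?case .
  qed
  have "\<kappa> \<le> card (A + B) / card A" using min[of A] A by (simp add: \<kappa>_def ratio_def)
  then show thesis
    using main X by (intro that[of X]) (meson mult_right_mono of_nat_0_le_iff order_trans)+
qed

text \<open>With \<open>K\<close> the ratio \<open>card (A + B) / card A\<close>, Petridis for
  \<open>C = {0}\<close> and \<open>C = B\<close> gives
  \<open>card (X + (B + B)) \<le> K^2 * card X\<close>. The triangle inequality with
  \<open>X\<close> as pivot squares the factor, and \<open>X \<subseteq> A\<close> finishes.\<close>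

lemma small_double_difference_set:
  fixes A B :: "'a::ab_group_add set"
  assumes A: "finite A" "A \<noteq> {}" and B: "finite B"
  shows "card ((\<lambda>(u, v). u - v) ` ((B + B) \<times> (B + B))) \<le> (card (A + B) / card A) ^ 4 * card A"
proof -
  obtain X where X: "X \<subseteq> A" "X \<noteq> {}" and
    P: "\<And>C. finite C \<Longrightarrow> card (X + B + C) \<le> card (A + B) / card A * card (X + C)"
    using Petridis[OF A B] by blast
  define K where "K = real (card (A + B)) / card A"
  have K0: "K \<ge> 0" by (simp add: K_def)
  have finX: "finite X" using X A finite_subset by blast
  have cX: "card X > 0" using finX X by (simp add: card_gt_0_iff)
  have "X + {0} = X" "X + B + {0} = X + B" by (auto simp: set_plus_def)
  then have "card (X + B) \<le> K * card X" using P[of "{0}"] by (simp add: K_def)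
  then have "K * card (X + B) \<le> K * (K * card X)" using K0 by (rule mult_left_mono)
  moreover have "card (X + B + B) \<le> K * card (X + B)" using P[OF B] by (simp add: K_def)
  ultimately have 1: "card (X + (B + B)) \<le> K\<^sup>2 * card X"
    by (simp add: add.assoc power2_eq_square mult_ac)
  have "real (card X) * card ((\<lambda>(u, v). u - v) ` ((B + B) \<times> (B + B))) \<le> (card (X + (B + B)))\<^sup>2"
    using Ruzsa_triangle[OF finX finite_set_plus[OF B B] finite_set_plus[OF B B]]
    unfolding of_nat_mult[symmetric] of_nat_power[symmetric] of_nat_le_iff by (simp add: power2_eq_square)
  also have "\<dots> \<le> (K\<^sup>2 * card X)\<^sup>2" using 1 by (simp add: power_mono)
  also have "\<dots> = card X * (K ^ 4 * card X)" by (simp add: power2_eq_square eval_nat_numeral)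
  finally have "card ((\<lambda>(u, v). u - v) ` ((B + B) \<times> (B + B))) \<le> K ^ 4 * card X"
    using cX by simp
  also have "\<dots> \<le> K ^ 4 * card A" using card_mono[OF A(1) X(1)] K0 by (intro mult_left_mono) auto
  finally show ?thesis by (simp add: K_def)
qed

subsection \<open>Progression-free sets and progression counts\<close>

lemma AP_free_iff: "AP_free k A \<longleftrightarrow> (\<forall>x d. d \<noteq> 0 \<longrightarrow> (\<exists>i<k. x + int i * d \<notin> A))"
  unfolding AP_free_def is_AP_def by blast

lemma AP_free_mono: "AP_free k A \<Longrightarrow> B \<subseteq> A \<Longrightarrow> AP_free k B"
  unfolding AP_free_def by blast

lemma is_AP_pos:
  assumes "is_AP k P"
  obtains x d where "d > 0" "P = (\<lambda>i. x + int i * d) ` {..<k}"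
proof -
  obtain x d where d: "d \<noteq> 0" "P = (\<lambda>i. x + int i * d) ` {..<k}"
    using assms by (auto simp: is_AP_def)
  show thesis
  proof (cases "d > 0")
    case True
    then show ?thesis using d that by blast
  next
    case False
    have "P = (\<lambda>i. (x + int (k - 1) * d) + int i * (- d)) ` {..<k}" (is "_ = ?f ` _")
    proof (intro subset_antisym subsetI)
      fix p assume "p \<in> P"
      then obtain i where i: "i < k" "p = x + int i * d" using d by auto
      then have "int (k - 1 - i) = int (k - 1) - int i" by simp
      then have "p = ?f (k - 1 - i)" using i(2) by (simp only:) (simp add: algebra_simps)
      moreover have "k - 1 - i \<in> {..<k}" using i by simp
      ultimately show "p \<in> ?f ` {..<k}" by (rule image_eqI)
    next
      fix p assume "p \<in> ?f ` {..<k}"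
      then obtain i where i: "i < k" "p = ?f i" by auto
      then have "int (k - 1 - i) = int (k - 1) - int i" by simp
      then have "p = x + int (k - 1 - i) * d" using i(2) by (simp only:) (simp add: algebra_simps)
      moreover have "k - 1 - i \<in> {..<k}" using i by simp
      ultimately show "p \<in> P" unfolding d by (rule image_eqI)
    qed
    moreover have "- d > 0" using False d(1) by simp
    ultimately show ?thesis using that by blast
  qed
qed

lemma AP_freeI:
  assumes "\<And>x d. d > 0 \<Longrightarrow> \<exists>i<k. x + int i * d \<notin> A"
  shows "AP_free k A"
  unfolding AP_free_def
proof
  assume "\<exists>P. is_AP k P \<and> P \<subseteq> A"
  then obtain P where P: "is_AP k P" "P \<subseteq> A" by blast
  obtain x d where d: "d > 0" "P = (\<lambda>i. x + int i * d) ` {..<k}" using is_AP_pos[OF P(1)] .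
  then show False using assms[of d x] P(2) by blast
qed

lemma AP_free_singleton:
  assumes "k \<ge> 2"
  shows "AP_free k {a}"
  unfolding AP_free_iff
proof (intro allI impI)
  fix x d :: int assume "d \<noteq> 0"
  then have "x + int 0 * d \<notin> {a} \<or> x + int 1 * d \<notin> {a}" by auto
  moreover have "0 < k" "1 < k" using assms by auto
  ultimately show "\<exists>i<k. x + int i * d \<notin> {a}" by blast
qed

lemma AP_free_translate:
  assumes "AP_free k A"
  shows "AP_free k ((\<lambda>x. x + c) ` A)"
  unfolding AP_free_iff
proof (intro allI impI)
  fix x d :: int assume "d \<noteq> 0"
  then obtain i where "i < k" "(x - c) + int i * d \<notin> A" using assms unfolding AP_free_iff by blast
  moreover have "x - c + int i * d = x + int i * d - c" by simp
  ultimately have "x + int i * d \<notin> (\<lambda>x. x + c) ` A" by auto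
  then show "\<exists>i<k. x + int i * d \<notin> (\<lambda>x. x + c) ` A" using \<open>i < k\<close> by blast
qed

text \<open>Used twice: for preimages of a progression under a model map, and for the window indices
  met by a progression.\<close>

lemma second_difference_zero:
  fixes a :: "nat \<Rightarrow> int"
  assumes "\<And>j. j + 2 < k \<Longrightarrow> a j + a (j + 2) = 2 * a (j + 1)" and "i < k"
  shows "a i = a 0 + int i * (a 1 - a 0)"
  using assms(2)
proof (induction i rule: less_induct)
  case (less i)
  consider "i = 0" | "i = 1" | j where "i = j + 2"
    by (metis One_nat_def Suc_1 add_2_eq_Suc' not0_implies_Suc)
  then show ?case
  proof cases
    case 3
    have "a j + a i = 2 * a (j + 1)" using assms(1)[of j] less.prems 3 by simp
    moreover have "a j = a 0 + int j * (a 1 - a 0)" "a (j + 1) = a 0 + int (j + 1) * (a 1 - a 0)"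
      using less.IH[of j] less.IH[of "j + 1"] less.prems 3 by simp_all
    ultimately show ?thesis using 3 by (simp add: algebra_simps)
  qed auto
qed

text \<open>A progression in the image is pulled back term by term: consecutive triples of preimages
  satisfy the midpoint equation, so the preimages form a progression, nonconstant because their
  images differ.\<close>

lemma AP_free_image:
  assumes A: "AP_free k A" and k: "k \<ge> 2"
    and \<phi>: "\<And>x y z. x \<in> A \<Longrightarrow> y \<in> A \<Longrightarrow> z \<in> A \<Longrightarrow> \<phi> x + \<phi> z = 2 * \<phi> y \<Longrightarrow> x + z = 2 * y"
  shows "AP_free k (\<phi> ` A)"
  unfolding AP_free_iff
proof (intro allI impI, rule ccontr)
  fix x d :: int assume d: "d \<noteq> 0" and "\<not> (\<exists>i<k. x + int i * d \<notin> \<phi> ` A)"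
  then have "\<forall>i. \<exists>a. i < k \<longrightarrow> a \<in> A \<and> \<phi> a = x + int i * d" by (metis imageE)
  then obtain a where a: "\<And>i. i < k \<Longrightarrow> a i \<in> A" "\<And>i. i < k \<Longrightarrow> \<phi> (a i) = x + int i * d"
    by metis
  define e where "e = a 1 - a 0"
  have "\<phi> (a 0) \<noteq> \<phi> (a 1)" using a(2)[of 0] a(2)[of 1] k d by simp
  then have e: "e \<noteq> 0" by (auto simp: e_def)
  have "a j + a (j + 2) = 2 * a (j + 1)" if "j + 2 < k" for j
    by (rule \<phi>) (use a that in \<open>auto simp: algebra_simps\<close>)
  then have "a i = a 0 + int i * e" if "i < k" for i
    unfolding e_def using second_difference_zero[of k a i] that by simp
  then have "\<forall>i<k. a 0 + int i * e \<in> A" using a(1) by metis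
  then show False using A e unfolding AP_free_iff by blast
qed

section \<open>The extremal size \<open>r_AP\<close>\<close>

lemma finite_r_AP_set: "finite {card A |A. A \<subseteq> {1..int n} \<and> AP_free k A}"
  by (rule finite_subset[of _ "card ` Pow {1..int n}"]) auto

text \<open>The half-open interval contains exactly \<open>n\<close> integers, and intervals of this
  form tile the line, as the block argument below requires.\<close>

lemma card_le_r_AP:
  assumes "A \<subseteq> {a<..a + int n}" "AP_free k A"
  shows "card A \<le> r_AP k n"
proof -
  let ?B = "(\<lambda>x. x + (- a)) ` A"
  have "card ?B \<le> r_AP k n"
    unfolding r_AP_def
    by (rule Max_ge[OF finite_r_AP_set]) (use assms AP_free_translate[of k A "- a"] in force)
  moreover have "card ?B = card A" by (rule card_image) (auto intro: inj_onI)
  ultimately show ?thesis by simp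
qed

lemma r_AP_attained:
  assumes "k > 0"
  obtains A where "A \<subseteq> {1..int n}" "AP_free k A" "card A = r_AP k n"
proof -
  have "AP_free k {}" using assms unfolding AP_free_iff by auto
  then have "{card A |A. A \<subseteq> {1..int n} \<and> AP_free k A} \<noteq> {}" by blast
  then have "r_AP k n \<in> {card A |A. A \<subseteq> {1..int n} \<and> AP_free k A}"
    unfolding r_AP_def by (rule Max_in[OF finite_r_AP_set])
  then obtain A where "A \<subseteq> {1..int n}" "AP_free k A" "r_AP k n = card A" by blast
  then show thesis using that by simp
qed

lemma r_AP_le:
  assumes "k > 0"
  shows "r_AP k n \<le> n"
proof -
  obtain A where "A \<subseteq> {1..int n}" "card A = r_AP k n" using r_AP_attained[OF assms] .
  then show ?thesis using card_mono[of "{1..int n}" A] by simp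
qed

lemma r_AP_pos:
  assumes "k \<ge> 2" "n > 0"
  shows "r_AP k n > 0"
proof -
  have "AP_free k {1}" using assms(1) by (rule AP_free_singleton)
  then have "card {1::int} \<le> r_AP k n" using assms by (intro card_le_r_AP[of _ 0]) auto
  then show ?thesis by simp
qed

text \<open>Cutting \<open>{1..N}\<close> into blocks of length \<open>n\<close>, the last one
  possibly partial, compares densities at two scales: the model interval with \<open>n\<close> in
  the upper bound, and \<open>n\<close> with \<open>n div s\<close> in the lower bound.\<close>

lemma r_AP_subadditive:
  assumes k: "k > 0" and n: "n > 0"
  shows "r_AP k N \<le> (N div n + 1) * r_AP k n"
proof -
  obtain S where S: "S \<subseteq> {1..int N}" "AP_free k S" "card S = r_AP k N" using r_AP_attained[OF k] .
  define T where "T j = S \<inter> {int (j * n)<..int (j * n) + int n}" for j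
  have "S \<subseteq> (\<Union>j\<in>{..N div n}. T j)"
  proof
    fix x assume x: "x \<in> S"
    define y where "y = nat x - 1"
    have "1 \<le> x" "x \<le> int N" using x S(1) by auto
    then have xy: "x = int y + 1" "y < N" unfolding y_def by linarith+
    have "y div n \<le> N div n" using xy by (simp add: div_le_mono)
    moreover have "x \<in> T (y div n)"
    proof -
      have "y div n * n \<le> y" by simp
      moreover have "y < y div n * n + n" using dividend_less_div_times[OF n, of y] by linarith
      ultimately have "int (y div n * n) < x \<and> x \<le> int (y div n * n) + int n" using xy by linarith
      then show ?thesis using x unfolding T_def by simp
    qed
    ultimately show "x \<in> (\<Union>j\<in>{..N div n}. T j)" by blast
  qed
  moreover have finS: "finite S" using S finite_subset by blast
  ultimately have "card S \<le> card (\<Union>j\<in>{..N div n}. T j)" by (intro card_mono) (auto simp: T_def)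
  also have "\<dots> \<le> (\<Sum>j\<in>{..N div n}. card (T j))" by (rule card_UN_le) simp
  also have "\<dots> \<le> (\<Sum>j\<in>{..N div n}. r_AP k n)"
    by (intro sum_mono card_le_r_AP AP_free_mono[OF S(2)]) (auto simp: T_def)
  finally show ?thesis using S by simp
qed

section \<open>Elementary bounds on the number of progressions\<close>

lemma finite_APs: "finite A \<Longrightarrow> finite {P. is_AP s P \<and> P \<subseteq> A}"
  by (rule finite_subset[of _ "Pow A"]) auto

lemma AP_count_le_power: "finite A \<Longrightarrow> AP_count s A \<le> 2 ^ card A"
  unfolding AP_count_def card_Pow[symmetric] by (rule card_mono) auto

text \<open>Oriented upwards, a progression is determined by its first and third terms, and the
  second term is their midpoint. This turns progressions into edges of a graph.\<close>

lemma AP_count_le_midpoint_pairs: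
  assumes "finite A" "s \<ge> 3"
  shows "AP_count s A \<le> card {(x, z) \<in> A \<times> A. x < z \<and> (\<exists>y\<in>A. x + z = 2 * y)}"
proof -
  let ?E = "{(x, z) \<in> A \<times> A. x < z \<and> (\<exists>y\<in>A. x + z = 2 * y)}"
  let ?f = "\<lambda>(x::int, z). (\<lambda>i. x + int i * ((z - x) div 2)) ` {..<s}"
  have fin: "finite ?E" by (rule finite_subset[of _ "A \<times> A"]) (use assms in auto)
  have "{P. is_AP s P \<and> P \<subseteq> A} \<subseteq> ?f ` ?E"
  proof clarify
    fix P assume P: "is_AP s P" "P \<subseteq> A"
    obtain x d where d: "d > 0" "P = (\<lambda>i. x + int i * d) ` {..<s}" using is_AP_pos[OF P(1)] .
    have mem: "x + int i * d \<in> A" if "i < s" for i using P d that by blast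
    have "(x, x + 2 * d) \<in> ?E"
      using mem[of 0] mem[of 1] mem[of 2] assms d by (auto intro!: bexI[of _ "x + d"])
    moreover have "P = ?f (x, x + 2 * d)" using d by simp
    ultimately show "P \<in> ?f ` ?E" by blast
  qed
  then have "AP_count s A \<le> card (?f ` ?E)"
    unfolding AP_count_def by (rule card_mono[rotated]) (use fin in auto)
  also have "\<dots> \<le> card ?E" using fin by (rule card_image_le)
  finally show ?thesis .
qed

text \<open>The pairs and their mirror images are disjoint. The factor 2 keeps the progression
  density at most 1/2, which is what later absorbs constants into the exponent.\<close>

lemma card_ordered_pairs_le:
  fixes A :: "int set"
  assumes "finite A"
  shows "2 * card {(x, z) \<in> A \<times> A. x < z} \<le> (card A)\<^sup>2"
proof -
  let ?E = "{(x, z) \<in> A \<times> A. x < z}"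
  have fin: "finite ?E" by (rule finite_subset[of _ "A \<times> A"]) (use assms in auto)
  have "card (?E \<union> prod.swap ` ?E) = card ?E + card (prod.swap ` ?E)"
    by (rule card_Un_disjoint) (use fin in auto)
  moreover have "card (prod.swap ` ?E) = card ?E" by (simp add: card_image)
  moreover have "card (?E \<union> prod.swap ` ?E) \<le> card (A \<times> A)"
    by (rule card_mono) (use assms in auto)
  ultimately show ?thesis by (simp add: card_cartesian_product power2_eq_square)
qed

subsection \<open>Ruzsa's model lemma\<close>

text \<open>For fixed nonzero \<open>z\<close> the residues \<open>q * z mod p\<close> are distinct
  and nonzero as \<open>q\<close> varies, so at most \<open>(p - 1) div N\<close> dilations produce
  a multiple of \<open>N\<close>. Fewer than \<open>N\<close> values of \<open>z\<close> cannot rule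
  out all \<open>p - 1\<close> dilations.\<close>

lemma prime_dilation_avoiding_multiples:
  fixes D :: "int set"
  assumes D: "finite D" and N: "card D < N" and p: "prime p" and big: "\<And>z. z \<in> D \<Longrightarrow> \<bar>z\<bar> < p"
  obtains q :: int where "\<And>z. z \<in> D \<Longrightarrow> z \<noteq> 0 \<Longrightarrow> \<not> int N dvd (q * z) mod p"
proof -
  have p1: "p > 1" using p prime_gt_1_int by blast
  define bad where "bad z = {q \<in> {1..p-1}. int N dvd (q * z) mod p}" for z
  have cbad: "card (bad z) * N \<le> nat (p - 1)" if z: "z \<in> D" "z \<noteq> 0" for z
  proof -
    have pz: "\<not> p dvd z" using big[OF z(1)] z(2) zdvd_imp_le[of p "\<bar>z\<bar>"] by auto
    have "card (bad z) \<le> card {1..(p - 1) div int N}"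
    proof (rule card_inj_on_le[where f = "\<lambda>q. (q * z) mod p div int N"])
      have "q = q'" if "q \<in> bad z" "q' \<in> bad z" "(q * z) mod p div int N = (q' * z) mod p div int N" for q q'
      proof -
        have "(q * z) mod p = (q' * z) mod p"
          using that N by (metis (mono_tags, lifting) bad_def dvd_div_mult_self mem_Collect_eq)
        then have "p dvd (q - q') * z" by (simp add: mod_eq_dvd_iff left_diff_distrib)
        then have "p dvd q - q'" using p pz prime_dvd_multD by blast
        moreover have "\<bar>q - q'\<bar> < p" using that by (auto simp: bad_def)
        ultimately show ?thesis using zdvd_imp_le[of p "\<bar>q - q'\<bar>"] by force
      qed
      then show "inj_on (\<lambda>q. (q * z) mod p div int N) (bad z)" by (rule inj_onI)
      show "(\<lambda>q. (q * z) mod p div int N) ` bad z \<subseteq> {1..(p - 1) div int N}"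
      proof clarify
        fix q assume q: "q \<in> bad z"
        have "\<not> p dvd q" using q zdvd_imp_le[of p q] by (auto simp: bad_def)
        then have "\<not> p dvd q * z" using p pz prime_dvd_multD by blast
        then have "(q * z) mod p > 0" using p1 by (simp add: dvd_eq_mod_eq_0 pos_mod_sign order_less_le)
        moreover have "(q * z) mod p \<le> p - 1" using pos_mod_bound[of p "q * z"] p1 by linarith
        ultimately show "(q * z) mod p div int N \<in> {1..(p - 1) div int N}"
          using q N by (auto simp: bad_def zdiv_mono1 zdvd_imp_le pos_imp_zdiv_pos_iff int_one_le_iff_zero_less)
      qed
    qed simp
    then have "card (bad z) * N \<le> nat ((p - 1) div int N) * N" by simp
    also have "\<dots> \<le> nat (p - 1)"
    proof -
      have "(p - 1) div int N * int N \<le> p - 1"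
        using N by (metis div_mult_mod_eq le_add_same_cancel1 of_nat_0_less_iff gr_implies_not0 not_gr_zero pos_mod_sign)
      moreover have "(p - 1) div int N \<ge> 0" using p1 N by (simp add: pos_imp_zdiv_nonneg_iff)
      ultimately show ?thesis using p1
        by (metis nat_int nat_mono nat_mult_distrib)
    qed
    finally show ?thesis .
  qed
  have "(\<Union>z\<in>D - {0}. bad z) \<noteq> {1..p-1}"
  proof
    assume eq: "(\<Union>z\<in>D - {0}. bad z) = {1..p-1}"
    have "nat (p - 1) * N = card (\<Union>z\<in>D - {0}. bad z) * N" unfolding eq by simp
    also have "\<dots> \<le> (\<Sum>z\<in>D - {0}. card (bad z)) * N"
      using D by (intro mult_right_mono card_UN_le) auto
    also have "\<dots> = (\<Sum>z\<in>D - {0}. card (bad z) * N)" by (rule sum_distrib_right)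
    also have "\<dots> \<le> (\<Sum>z\<in>D - {0}. nat (p - 1))" by (intro sum_mono cbad) auto
    also have "\<dots> = card (D - {0}) * nat (p - 1)" by simp
    also have "\<dots> \<le> card D * nat (p - 1)" using D by (intro mult_right_mono card_mono) auto
    also have "\<dots> < N * nat (p - 1)" using N p1 by (intro mult_strict_right_mono) auto
    finally show False by (simp add: mult.commute)
  qed
  moreover have "(\<Union>z\<in>D - {0}. bad z) \<subseteq> {1..p-1}" by (auto simp: bad_def)
  ultimately obtain q where "q \<in> {1..p-1}" "\<And>z. z \<in> D - {0} \<Longrightarrow> q \<notin> bad z" by blast
  then show thesis using that[of q] by (auto simp: bad_def)
qed

text \<open>The map is dilation modulo \<open>p\<close> followed by reduction modulo
  \<open>N\<close>. A midpoint relation between images makes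
  \<open>u = \<rho> x + \<rho> z - 2 * \<rho> y\<close> a multiple of \<open>N\<close> congruent to
  \<open>q * w\<close> modulo \<open>p\<close>, where \<open>w = x + z - 2 * y\<close> lies in
  \<open>D\<close>. If \<open>\<bar>u\<bar> < p\<close>, the choice of \<open>q\<close> forces
  \<open>w = 0\<close>; symmetry of \<open>D\<close> covers negative \<open>u\<close>.\<close>

lemma Ruzsa_model:
  fixes B D :: "int set"
  assumes B: "finite B" and D: "finite D" "card D < N"
    and BD: "\<And>x y z. x \<in> B \<Longrightarrow> y \<in> B \<Longrightarrow> z \<in> B \<Longrightarrow> x + z - 2 * y \<in> D"
    and sym: "\<And>z. z \<in> D \<Longrightarrow> - z \<in> D"
  obtains B' \<phi> where "B' \<subseteq> B" "card B \<le> 2 * card B'" "\<phi> ` B' \<subseteq> {0..<int N}"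
    "\<And>x y z. x \<in> B' \<Longrightarrow> y \<in> B' \<Longrightarrow> z \<in> B' \<Longrightarrow> \<phi> x + \<phi> z = 2 * \<phi> y \<Longrightarrow> x + z = 2 * y"
proof -
  \<comment> \<open>The sum of absolute values exceeds no less than every single
    \<open>\<bar>z\<bar>\<close>, so \<open>p\<close> is larger than all of them.\<close>
  obtain p0 :: nat where p0: "prime p0" "nat (\<Sum>z\<in>D. \<bar>z\<bar>) < p0" using bigger_prime by blast
  define p where "p = int p0"
  have p: "prime p" using p0 by (simp add: p_def)
  have "\<bar>z\<bar> < p" if "z \<in> D" for z
    using member_le_sum[OF that, of abs] D(1) p0(2) unfolding p_def by auto
  then obtain q :: int where q: "\<And>z. z \<in> D \<Longrightarrow> z \<noteq> 0 \<Longrightarrow> \<not> int N dvd (q * z) mod p"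
    using prime_dilation_avoiding_multiples[OF D p] by blast
  have p1: "p > 1" using p prime_gt_1_int by blast
  define \<rho> where "\<rho> x = (q * x) mod p" for x
  define \<phi> where "\<phi> x = \<rho> x mod int N" for x
  have \<rho>: "0 \<le> \<rho> x" "\<rho> x < p" for x using p1 by (auto simp: \<rho>_def)
  \<comment> \<open>On either half of the residues \<open>\<rho> x + \<rho> z - 2 * \<rho> y\<close>
    stays strictly between \<open>-p\<close> and \<open>p\<close>; the larger half is kept, which
    costs the factor 2.\<close>
  define L where "L = {x \<in> B. 2 * \<rho> x < p}"
  define H where "H = {x \<in> B. 2 * \<rho> x \<ge> p}"
  have key: "x + z = 2 * y"
    if mem: "x \<in> B" "y \<in> B" "z \<in> B" and eq: "\<phi> x + \<phi> z = 2 * \<phi> y"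
      and range: "\<bar>\<rho> x + \<rho> z - 2 * \<rho> y\<bar> < p" for x y z
  proof (rule ccontr)
    assume "x + z \<noteq> 2 * y"
    define w where "w = x + z - 2 * y"
    define u where "u = \<rho> x + \<rho> z - 2 * \<rho> y"
    have w: "w \<in> D" "w \<noteq> 0" using BD[of x y z] mem \<open>x + z \<noteq> 2 * y\<close> by (auto simp: w_def)
    have \<rho>\<phi>: "\<rho> v = \<phi> v + int N * (\<rho> v div int N)" for v by (simp add: \<phi>_def)
    have "u = (\<phi> x + \<phi> z - 2 * \<phi> y) + int N * (\<rho> x div int N + \<rho> z div int N - 2 * (\<rho> y div int N))"
      unfolding u_def by (subst (1 2 3) \<rho>\<phi>) (simp add: algebra_simps)
    then have Nu: "int N dvd u" using eq by simp
    have q\<rho>: "\<rho> v = q * v - p * (q * v div p)" for v by (simp add: \<rho>_def minus_mult_div_eq_mod)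
    have "u = q * w + p * (2 * (q * y div p) - q * x div p - q * z div p)"
      unfolding u_def w_def by (subst (1 2 3) q\<rho>) (simp add: algebra_simps)
    then have um: "u mod p = (q * w) mod p" by simp
    show False
    proof (cases "u \<ge> 0")
      case True
      then have "u = (q * w) mod p" using um range by (simp add: u_def)
      then show False using q[OF w] Nu by simp
    next
      case False
      have "(- u) mod p = (q * (- w)) mod p" using um by (metis mod_minus_cong mult_minus_right)
      then have "- u = (q * (- w)) mod p" using False range by (simp add: u_def)
      then show False using q[OF sym[OF w(1)]] w(2) Nu by (metis dvd_minus_iff neg_equal_0_iff_equal)
    qed
  qed
  note result = that
  have model: thesis
    if C: "C \<subseteq> B" "card B \<le> 2 * card C"
      and half: "(\<forall>x\<in>C. 2 * \<rho> x < p) \<or> (\<forall>x\<in>C. 2 * \<rho> x \<ge> p)" for C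
  proof (rule result[OF C])
    show "\<phi> ` C \<subseteq> {0..<int N}" using D by (auto simp: \<phi>_def)
    fix x y z assume xyz: "x \<in> C" "y \<in> C" "z \<in> C" and eq: "\<phi> x + \<phi> z = 2 * \<phi> y"
    have "\<bar>\<rho> x + \<rho> z - 2 * \<rho> y\<bar> < p"
      using half
    proof
      assume "\<forall>x\<in>C. 2 * \<rho> x < p"
      then have "2 * \<rho> x < p" "2 * \<rho> y < p" "2 * \<rho> z < p" using xyz by auto
      then show ?thesis using \<rho>[of x] \<rho>[of y] \<rho>[of z] by linarith
    next
      assume "\<forall>x\<in>C. 2 * \<rho> x \<ge> p"
      then have "2 * \<rho> x \<ge> p" "2 * \<rho> y \<ge> p" "2 * \<rho> z \<ge> p" using xyz by auto
      then show ?thesis using \<rho>[of x] \<rho>[of y] \<rho>[of z] by linarith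
    qed
    then show "x + z = 2 * y" using key xyz C eq by blast
  qed
  have "B = L \<union> H" by (auto simp: L_def H_def)
  then have "card B \<le> card L + card H" using card_Un_le by metis
  then consider "card B \<le> 2 * card L" | "card B \<le> 2 * card H" by linarith
  then show thesis
  proof cases
    case 1
    then show ?thesis by (intro model[of L]) (auto simp: L_def)
  next
    case 2
    then show ?thesis by (intro model[of H]) (auto simp: H_def)
  qed
qed

subsection \<open>The upper bound\<close>

text \<open>A path \<open>a, b', a', b\<close> writes \<open>a + b = (a + b') - (a' + b') + (a' + b)\<close>, where each of the three
  sums on the right is twice an element of \<open>A\<close>.\<close>

lemma length_3_paths_imp_small_sumset:
  fixes A A' B' :: "int set" and \<beta> :: real
  assumes A: "finite A" and sub: "A' \<subseteq> A" "B' \<subseteq> A"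
    and E: "E \<subseteq> {(x, z) \<in> A \<times> A. \<exists>y\<in>A. x + z = 2 * y}"
    and paths: "\<And>a b. a \<in> A' \<Longrightarrow> b \<in> B' \<Longrightarrow>
       \<beta> \<le> card {(b', a'). (a, b') \<in> E \<and> (a', b') \<in> E \<and> (a', b) \<in> E}"
  shows "card (A' + B') * \<beta> \<le> real (card A) ^ 3"
proof -
  define P where "P a b = {(b', a'). (a, b') \<in> E \<and> (a', b') \<in> E \<and> (a', b) \<in> E}" for a b
  have "\<forall>\<sigma>\<in>A' + B'. \<exists>a b. a \<in> A' \<and> b \<in> B' \<and> \<sigma> = a + b" by (auto simp: set_plus_def)
  then obtain f g where fg: "\<And>\<sigma>. \<sigma> \<in> A' + B' \<Longrightarrow> f \<sigma> \<in> A' \<and> g \<sigma> \<in> B' \<and> \<sigma> = f \<sigma> + g \<sigma>"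
    by metis
  have finS: "finite (A' + B')" using sub A by (intro finite_set_plus) (auto intro: finite_subset)
  have finP: "finite (P a b)" for a b
    by (rule finite_subset[of _ "A \<times> A"]) (use A E in \<open>auto simp: P_def\<close>)
  \<comment> \<open>The three midpoints determine \<open>\<sigma>\<close>, hence its chosen summands
    \<open>f \<sigma>\<close> and \<open>g \<sigma>\<close>, and then \<open>b'\<close> and
    \<open>a'\<close>. So all sums with all their paths embed into triples from
    \<open>A\<close>.\<close>
  define F where "F = (\<lambda>(\<sigma>, b', a'). ((f \<sigma> + b') div 2, (a' + b') div 2, (a' + g \<sigma>) div 2))"
  define T where "T = Sigma (A' + B') (\<lambda>\<sigma>. P (f \<sigma>) (g \<sigma>))"
  have half: "2 * ((x + z) div 2) = x + z \<and> (x + z) div 2 \<in> A" if "(x, z) \<in> E" for x z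
    using E that by auto
  have "card T \<le> card (A \<times> A \<times> A)"
  proof (rule card_inj_on_le[of F])
    show "inj_on F T"
    proof (rule inj_onI)
      fix p q assume "p \<in> T" "q \<in> T" and eq: "F p = F q"
      then obtain \<sigma> b' a' \<tau> d' c' where pq: "p = (\<sigma>, b', a')" "q = (\<tau>, d', c')"
        and \<sigma>: "\<sigma> \<in> A' + B'" "(f \<sigma>, b') \<in> E" "(a', b') \<in> E" "(a', g \<sigma>) \<in> E"
        and \<tau>: "\<tau> \<in> A' + B'" "(f \<tau>, d') \<in> E" "(c', d') \<in> E" "(c', g \<tau>) \<in> E"
        unfolding T_def P_def by blast
      have F: "(f \<sigma> + b') div 2 = (f \<tau> + d') div 2" "(a' + b') div 2 = (c' + d') div 2"
        "(a' + g \<sigma>) div 2 = (c' + g \<tau>) div 2"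
        using eq by (simp_all add: pq F_def)
      have e: "f \<sigma> + b' = f \<tau> + d'" "a' + b' = c' + d'" "a' + g \<sigma> = c' + g \<tau>"
        using F half[OF \<sigma>(2)] half[OF \<sigma>(3)] half[OF \<sigma>(4)] half[OF \<tau>(2)] half[OF \<tau>(3)] half[OF \<tau>(4)]
        by linarith+
      have "\<sigma> = f \<sigma> + g \<sigma>" "\<tau> = f \<tau> + g \<tau>" using fg \<sigma>(1) \<tau>(1) by auto
      then have st: "\<sigma> = \<tau>" using e by linarith
      then show "p = q" using e pq by auto
    qed
    show "F ` T \<subseteq> A \<times> A \<times> A"
      using half by (auto simp: F_def T_def P_def)
  qed (use A in auto)
  also have "card T = (\<Sum>\<sigma>\<in>A' + B'. card (P (f \<sigma>) (g \<sigma>)))"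
    unfolding T_def using finS finP by (intro card_SigmaI) auto
  finally have "(\<Sum>\<sigma>\<in>A' + B'. card (P (f \<sigma>) (g \<sigma>))) \<le> card A ^ 3"
    by (simp add: card_cartesian_product power3_eq_cube mult.assoc)
  then have "(\<Sum>\<sigma>\<in>A' + B'. real (card (P (f \<sigma>) (g \<sigma>)))) \<le> real (card A) ^ 3"
    by (metis of_nat_le_iff of_nat_power of_nat_sum)
  moreover have "(\<Sum>\<sigma>\<in>A' + B'. \<beta>) \<le> (\<Sum>\<sigma>\<in>A' + B'. real (card (P (f \<sigma>) (g \<sigma>))))"
    by (rule sum_mono) (use fg paths in \<open>auto simp: P_def\<close>)
  ultimately show ?thesis by simp
qed

text \<open>The exponent is 25 = 1 + 4 * 6: one factor \<open>\<epsilon>\<close> from the size of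
  \<open>B'\<close>, and the fourth power of the doubling ratio \<open>K\<close>, which is of order
  \<open>\<epsilon> ^ (-6)\<close>.\<close>

lemma many_midpoints_imp_r_AP_large:
  fixes A :: "int set" and \<epsilon> :: real
  assumes A: "finite A" "card A = n" "n > 0" "AP_free k A" and k: "k \<ge> 2"
    and \<epsilon>: "0 < \<epsilon>" "\<epsilon> \<le> 1"
    and many: "\<epsilon> * real n ^ 2 \<le> card {(x, z) \<in> A \<times> A. x < z \<and> (\<exists>y\<in>A. x + z = 2 * y)}"
  shows "\<epsilon> ^ 25 / (24 * 18432 ^ 4) \<le> r_AP k n / n"
proof -
  define E where "E = {(x, z) \<in> A \<times> A. x < z \<and> (\<exists>y\<in>A. x + z = 2 * y)}"
  have EA: "E \<subseteq> A \<times> A" by (auto simp: E_def)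
  obtain A' B' where sub: "A' \<subseteq> A" "B' \<subseteq> A"
    and large: "\<epsilon> * n / 6 \<le> card A'" "\<epsilon> * n / 4 \<le> card B'"
    and paths: "\<And>a b. a \<in> A' \<Longrightarrow> b \<in> B' \<Longrightarrow>
       \<epsilon> ^ 5 * real n ^ 2 / 3072 \<le> card {(b', a'). (a, b') \<in> E \<and> (a', b') \<in> E \<and> (a', b) \<in> E}"
    by (rule dense_bipartite_many_paths[OF A(1) A(1) A(2) A(2) EA _ \<epsilon>(1) A(3)])
      (use many in \<open>simp_all add: E_def\<close>)
  \<comment> \<open>18432 = 6 * 3072: \<open>A' + B'\<close> has at most
    \<open>3072 * n / \<epsilon> ^ 5\<close> elements and \<open>A'\<close> at least
    \<open>\<epsilon> * n / 6\<close>.\<close>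
  define K where "K = 18432 / \<epsilon> ^ 6"
  have \<epsilon>6: "\<epsilon> ^ 6 \<le> 1" using \<epsilon> by (simp add: power_le_one)
  then have K: "K \<ge> 1" using \<epsilon> by (simp add: K_def field_simps)
  have fin: "finite A'" "finite B'" using sub A finite_subset by blast+
  have "\<epsilon> * n / 6 > 0" using \<epsilon> A by simp
  then have cA': "card A' > 0" using large by linarith
  have "card (A' + B') * (\<epsilon> ^ 5 * real n ^ 2 / 3072) \<le> real (card A) ^ 3"
    by (rule length_3_paths_imp_small_sumset[OF A(1) sub _ paths]) (auto simp: E_def)
  then have "card (A' + B') \<le> 3072 * n / \<epsilon> ^ 5"
    using A \<epsilon> by (simp add: field_simps power2_eq_square power3_eq_cube)
  also have "\<dots> = K * (\<epsilon> * n / 6)" using \<epsilon> by (simp add: K_def field_simps eval_nat_numeral)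
  also have "\<dots> \<le> K * card A'" using large K by (intro mult_left_mono) auto
  finally have ratio: "card (A' + B') / card A' \<le> K" using cA' by (simp add: field_simps)
  \<comment> \<open>\<open>D\<close> is 2B' - 2B', a symmetric set containing every
    \<open>x + z - 2 * y\<close> with entries in \<open>B'\<close>.\<close>
  define D where "D = (\<lambda>(u, v). u - v) ` ((B' + B') \<times> (B' + B'))"
  have finD: "finite D" unfolding D_def using fin by (intro finite_imageI finite_cartesian_product finite_set_plus)
  have "card D \<le> (card (A' + B') / card A') ^ 4 * card A'"
    unfolding D_def using fin cA' by (intro small_double_difference_set) auto
  also have "\<dots> \<le> K ^ 4 * n"
    using ratio card_mono[OF A(1) sub(1)] A K by (intro mult_mono power_mono) auto
  finally have cD: "card D \<le> K ^ 4 * n" .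
  define N where "N = card D + 1"
  obtain C \<phi> where C: "C \<subseteq> B'" "card B' \<le> 2 * card C" "\<phi> ` C \<subseteq> {0..<int N}"
    and \<phi>: "\<And>x y z. x \<in> C \<Longrightarrow> y \<in> C \<Longrightarrow> z \<in> C \<Longrightarrow> \<phi> x + \<phi> z = 2 * \<phi> y \<Longrightarrow> x + z = 2 * y"
  proof (rule Ruzsa_model[OF fin(2) finD, of N])
    show "card D < N" by (simp add: N_def)
    show "x + z - 2 * y \<in> D" if "x \<in> B'" "y \<in> B'" "z \<in> B'" for x y z
    proof -
      have "(x + z, y + y) \<in> (B' + B') \<times> (B' + B')" using that by (blast intro: set_plus_intro)
      then show ?thesis unfolding D_def by (rule rev_image_eqI) simp
    qed
    show "- z \<in> D" if z: "z \<in> D" for z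
    proof -
      obtain w where w: "z = (\<lambda>(u, v). u - v) w" "w \<in> (B' + B') \<times> (B' + B')"
        using z unfolding D_def by (rule imageE)
      have "- z = (\<lambda>(u, v). u - v) (prod.swap w)" unfolding w(1) by (cases w) simp
      moreover have "prod.swap w \<in> (B' + B') \<times> (B' + B')" using w(2) by (cases w) simp
      ultimately show ?thesis unfolding D_def by (rule image_eqI)
    qed
  qed blast
  have "AP_free k C" using C(1) sub(2) by (intro AP_free_mono[OF A(4)]) blast
  then have "AP_free k (\<phi> ` C)" using k \<phi> by (rule AP_free_image)
  moreover have "\<phi> ` C \<subseteq> {-1<..-1 + int N}" using C(3) by auto
  ultimately have "card (\<phi> ` C) \<le> r_AP k N" by (intro card_le_r_AP)
  moreover have "inj_on \<phi> C"
  proof (rule inj_onI)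
    fix x y assume "x \<in> C" "y \<in> C" "\<phi> x = \<phi> y"
    then show "x = y" using \<phi>[of x y y] by simp
  qed
  ultimately have "card C \<le> r_AP k N" by (simp add: card_image)
  also have "\<dots> \<le> (N div n + 1) * r_AP k n" using k A by (intro r_AP_subadditive) auto
  finally have "real (card C) \<le> real ((N div n + 1) * r_AP k n)" by (rule of_nat_mono)
  \<comment> \<open>\<open>N / n\<close> is at most \<open>K ^ 4 + 1\<close>, and
    \<open>K \<ge> 1\<close> absorbs the remaining additive terms.\<close>
  also have "\<dots> \<le> (3 * K ^ 4) * r_AP k n"
  proof -
    have "real (N div n) \<le> N / n" by (rule of_nat_div_le_of_nat)
    also have "\<dots> \<le> (K ^ 4 * n + n) / n" using cD A(3) by (intro divide_right_mono) (auto simp: N_def)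
    also have "\<dots> = K ^ 4 + 1" using A(3) by (simp add: field_simps)
    finally have "real (N div n + 1) \<le> 3 * K ^ 4" using one_le_power[OF K, of 4] by simp
    then show ?thesis by (simp only: of_nat_mult mult_right_mono of_nat_0_le_iff)
  qed
  finally have "\<epsilon> * n / 8 \<le> 3 * K ^ 4 * r_AP k n" using large(2) C(2) by linarith
  then have "\<epsilon> / (24 * K ^ 4) \<le> r_AP k n / n" using K A(3) by (simp add: field_simps)
  moreover have "\<epsilon> / (24 * K ^ 4) = \<epsilon> ^ 25 / (24 * 18432 ^ 4)"
    using \<epsilon> by (simp add: K_def field_simps eval_nat_numeral)
  ultimately show ?thesis by simp
qed

lemma AP_count_upper_bound:
  fixes A :: "int set"
  assumes A: "finite A" "card A = n" "n > 0" "AP_free k A" and k: "k \<ge> 2" and s: "s \<ge> 3"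
  shows "AP_count s A \<le> (r_AP k n / n) powr (1 / 87) * real n ^ 2"
proof (cases "AP_count s A = 0")
  case False
  define \<epsilon> where "\<epsilon> = AP_count s A / real n ^ 2"
  have \<epsilon>: "\<epsilon> > 0" using False A by (simp add: \<epsilon>_def)
  have cnt: "AP_count s A \<le> card {(x, z) \<in> A \<times> A. x < z \<and> (\<exists>y\<in>A. x + z = 2 * y)}"
    by (rule AP_count_le_midpoint_pairs[OF A(1) s])
  also have "\<dots> \<le> card {(x, z) \<in> A \<times> A. x < z}"
    by (rule card_mono[OF finite_subset[of _ "A \<times> A"]]) (use A in auto)
  finally have "2 * AP_count s A \<le> n\<^sup>2" using card_ordered_pairs_le[OF A(1)] unfolding A(2) by linarith
  then have "2 * real (AP_count s A) \<le> real n ^ 2" by (metis of_nat_le_iff of_nat_mult of_nat_numeral of_nat_power)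
  then have half: "\<epsilon> \<le> 1 / 2" using A(3) by (simp add: \<epsilon>_def field_simps)
  have "\<epsilon> * real n ^ 2 \<le> card {(x, z) \<in> A \<times> A. x < z \<and> (\<exists>y\<in>A. x + z = 2 * y)}"
    using cnt A(3) by (simp add: \<epsilon>_def)
  then have "\<epsilon> ^ 25 / (24 * 18432 ^ 4) \<le> r_AP k n / n"
    using A k \<epsilon> half by (intro many_midpoints_imp_r_AP_large) auto
  \<comment> \<open>87 = 25 + 62, where 24 * 18432^4 = 2^47 * 3^9 is below 2^62.\<close>
  moreover have "\<epsilon> ^ 87 \<le> \<epsilon> ^ 25 / (24 * 18432 ^ 4)"
  proof -
    have "\<epsilon> ^ 62 \<le> (1 / 2) ^ 62" using half \<epsilon> by (intro power_mono) auto
    also have "\<dots> \<le> 1 / (24 * 18432 ^ 4)" by (simp add: power_divide)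
    finally have "\<epsilon> ^ 25 * \<epsilon> ^ 62 \<le> \<epsilon> ^ 25 * (1 / (24 * 18432 ^ 4))"
      using \<epsilon> by (intro mult_left_mono) auto
    then show ?thesis by (simp flip: power_add)
  qed
  ultimately have "\<epsilon> ^ 87 \<le> r_AP k n / n" by linarith
  then have "(\<epsilon> ^ 87) powr (1 / 87) \<le> (r_AP k n / n) powr (1 / 87)"
    using \<epsilon> by (intro powr_mono2) auto
  moreover have "(\<epsilon> ^ 87) powr (1 / 87) = \<epsilon>"
  proof -
    have "\<epsilon> ^ 87 = \<epsilon> powr 87" using \<epsilon> by simp
    then show ?thesis using \<epsilon> by (simp only: powr_powr) simp
  qed
  ultimately have "\<epsilon> * real n ^ 2 \<le> (r_AP k n / n) powr (1 / 87) * real n ^ 2"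
    by (simp add: mult_right_mono)
  then show ?thesis using A(3) by (simp add: \<epsilon>_def)
qed simp

subsection \<open>The lower bound\<close>

text \<open>If the two largest terms lie in different parts, the step exceeds \<open>M\<close> and the third largest
  term would be negative; otherwise the step is at most \<open>L\<close>, too short to cross the gap.\<close>

lemma AP_free_far_union:
  fixes A B :: "int set"
  assumes A: "AP_free k A" "A \<subseteq> {0..M}" and B: "AP_free k B" "B \<subseteq> {0..L}"
    and N: "N > 2 * M" "N > M + L" and k: "k \<ge> 3" and ML0: "M \<ge> 0" "L \<ge> 0"
  shows "AP_free k (A \<union> (\<lambda>x. x + N) ` B)"
proof (rule AP_freeI, rule ccontr)
  let ?B = "(\<lambda>x. x + N) ` B"
  fix x d :: int assume d: "d > 0" and "\<not> (\<exists>i<k. x + int i * d \<notin> A \<union> ?B)"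
  then have mem: "x + int i * d \<in> A \<union> ?B" if "i < k" for i using that by blast
  have inA: "y < N" "0 \<le> y" "y \<le> M" if "y \<in> A" for y using that A(2) N ML0 by force+
  have inB: "N \<le> y" "y \<le> N + L" if "y \<in> ?B" for y using that B(2) by force+
  \<comment> \<open>The last three terms get the indices \<open>j\<close>, \<open>j + 1\<close> and
    \<open>j + 2\<close>.\<close>
  obtain j where j: "k = j + 3" using k by (metis le_add_diff_inverse2)
  have nonneg: "x + int i * d \<ge> 0" if "i < k" for i
    using mem[OF that]
  proof
    assume "x + int i * d \<in> A"
    then show ?thesis by (rule inA)
  next
    assume "x + int i * d \<in> ?B"
    then have "N \<le> x + int i * d" by (rule inB)
    then show ?thesis using N ML0 by linarith
  qed
  consider "x + int (j + 2) * d < N" | "x + int (j + 2) * d \<ge> N" "x + int (j + 1) * d < N"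
    | "x + int (j + 1) * d \<ge> N" by linarith
  then show False
  proof cases
    case 1
    have "x + int i * d \<in> A" if "i < k" for i
    proof -
      have "int i * d \<le> int (j + 2) * d" using that j d by (intro mult_right_mono) auto
      then have "x + int i * d < N" using 1 by linarith
      then show ?thesis using mem[OF that] inB(1) by force
    qed
    then show False using A(1) d unfolding AP_free_iff by (metis less_irrefl)
  next
    case 2
    have "x + int (j + 1) * d \<in> A" using mem[of "j + 1"] inB(1) 2(2) j by force
    then have "x + int (j + 1) * d \<le> M" by (rule inA)
    then have "x + int j * d < 0" using 2(1) N by (simp add: algebra_simps)
    then show False using nonneg[of j] j by simp
  next
    case 3
    have le: "int (j + 1) * d \<le> int (j + 2) * d" using d by (intro mult_right_mono) auto
    then have "x + int (j + 2) * d \<in> ?B" using mem[of "j + 2"] inA(1) 3 j by force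
    then have dL: "d \<le> L" using inB(2)[of "x + int (j + 2) * d"] 3 by (simp add: algebra_simps)
    have ge: "x + int (j + 2 - i) * d \<ge> N" if "i \<le> j + 2" for i
      using that
    proof (induction i)
      case 0
      then show ?case using le 3 by simp
    next
      case (Suc i)
      have "int (j + 2 - i) = int (j + 2 - Suc i) + 1" using Suc.prems by simp
      then have "x + int (j + 2 - Suc i) * d \<ge> N - L"
        using Suc dL by (simp add: algebra_simps)
      then have "x + int (j + 2 - Suc i) * d > M" using N by linarith
      moreover have "j + 2 - Suc i < k" using j by simp
      ultimately have "x + int (j + 2 - Suc i) * d \<in> ?B"
        using mem[of "j + 2 - Suc i"] inA(3)[of "x + int (j + 2 - Suc i) * d"] by force
      then show ?case by (rule inB)
    qed
    have "x + int i * d \<in> ?B" if "i < k" for i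
    proof -
      have "j + 2 - (j + 2 - i) = i" using that j by simp
      then have "x + int i * d \<ge> N" using ge[of "j + 2 - i"] by simp
      then show ?thesis using mem[OF that] inA(1) by force
    qed
    then show False using AP_free_translate[OF B(1), of N] d unfolding AP_free_iff by (metis less_irrefl)
  qed
qed

lemma AP_count_translate_le:
  assumes "finite A"
  shows "AP_count s A \<le> AP_count s ((\<lambda>x. x + c) ` A)"
  unfolding AP_count_def
proof (rule card_inj_on_le)
  let ?f = "\<lambda>P. (\<lambda>x::int. x + c) ` P"
  show "inj_on ?f {P. is_AP s P \<and> P \<subseteq> A}"
    by (rule inj_onI) (simp add: inj_image_eq_iff)
  show "?f ` {P. is_AP s P \<and> P \<subseteq> A} \<subseteq> {P. is_AP s P \<and> P \<subseteq> ?f A}"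
  proof clarify
    fix P assume P: "is_AP s P" "P \<subseteq> A"
    obtain x d where d: "d \<noteq> 0" "P = (\<lambda>i. x + int i * d) ` {..<s}" using P(1) by (auto simp: is_AP_def)
    have "?f P = (\<lambda>i. (x + c) + int i * d) ` {..<s}" unfolding d by (auto simp: image_image ac_simps)
    then show "is_AP s (?f P) \<and> ?f P \<subseteq> ?f A" using d(1) P(2) unfolding is_AP_def by blast
  qed
  show "finite {P. is_AP s P \<and> P \<subseteq> ?f A}" using assms by (intro finite_APs) simp
qed

lemma AP_count_disjoint_Un:
  assumes "finite A" "finite B" "A \<inter> B = {}" "s > 0"
  shows "AP_count s A + AP_count s B \<le> AP_count s (A \<union> B)"
proof -
  have "P \<noteq> {}" if "is_AP s P" for P using that assms(4) by (auto simp: is_AP_def)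
  then have "{P. is_AP s P \<and> P \<subseteq> A} \<inter> {P. is_AP s P \<and> P \<subseteq> B} = {}" using assms(3) by blast
  then have "AP_count s A + AP_count s B = card ({P. is_AP s P \<and> P \<subseteq> A} \<union> {P. is_AP s P \<and> P \<subseteq> B})"
    unfolding AP_count_def using assms finite_APs by (intro card_Un_disjoint[symmetric]) auto
  also have "\<dots> \<le> AP_count s (A \<union> B)"
    unfolding AP_count_def using assms by (intro card_mono finite_APs) auto
  finally show ?thesis .
qed

lemma AP_free_join:
  assumes A: "A \<subseteq> {0..}" "finite A" "AP_free k A" and B: "B \<subseteq> {0..}" "finite B" "AP_free k B"
    and k: "k \<ge> 3" and s: "s > 0"
  obtains C where "C \<subseteq> {0..}" "finite C" "card C = card A + card B" "AP_free k C"
    "AP_count s A + AP_count s B \<le> AP_count s C"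
proof -
  \<comment> \<open>Sums of absolute values bound the elements even when a set is empty;
    \<open>N\<close> exceeds both \<open>2 * M\<close> and \<open>M + L\<close>.\<close>
  define M where "M = (\<Sum>x\<in>A. \<bar>x\<bar>)"
  define L where "L = (\<Sum>x\<in>B. \<bar>x\<bar>)"
  define N where "N = 2 * M + L + 1"
  let ?B = "(\<lambda>x. x + N) ` B"
  have nonneg: "M \<ge> 0" "L \<ge> 0" by (auto simp: M_def L_def sum_nonneg)
  have AM: "A \<subseteq> {0..M}"
  proof
    fix x assume "x \<in> A"
    then show "x \<in> {0..M}" using A member_le_sum[of x A abs] by (auto simp: M_def)
  qed
  have BL: "B \<subseteq> {0..L}"
  proof
    fix x assume "x \<in> B"
    then show "x \<in> {0..L}" using B member_le_sum[of x B abs] by (auto simp: L_def)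
  qed
  have disj: "A \<inter> ?B = {}" using AM BL nonneg by (force simp: N_def)
  have cB: "card ?B = card B" by (rule card_image) (auto intro: inj_onI)
  show thesis
  proof (rule that[of "A \<union> ?B"])
    show "A \<union> ?B \<subseteq> {0..}" using AM BL nonneg by (force simp: N_def)
    show "finite (A \<union> ?B)" using A B by simp
    show "card (A \<union> ?B) = card A + card B" using A B disj cB by (simp add: card_Un_disjoint)
    show "AP_free k (A \<union> ?B)"
      using A B AM BL nonneg k by (intro AP_free_far_union[of k A M B L N]) (auto simp: N_def)
    have "AP_count s A + AP_count s B \<le> AP_count s A + AP_count s ?B"
      using B AP_count_translate_le by simp
    also have "\<dots> \<le> AP_count s (A \<union> ?B)" using A B disj s by (intro AP_count_disjoint_Un) auto
    finally show "AP_count s A + AP_count s B \<le> AP_count s (A \<union> ?B)" .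
  qed
qed

text \<open>Points are added one at a time, each far beyond the others; this makes the maximum in
  \<open>max_AP_count\<close> one over a nonempty set.\<close>

lemma AP_free_exists:
  assumes k: "k \<ge> 3"
  shows "\<exists>A. A \<subseteq> {0..} \<and> finite A \<and> card A = n \<and> AP_free k A"
proof (induction n)
  case 0
  have "k > 0" using k by simp
  then have "AP_free k {}" unfolding AP_free_iff by auto
  then show ?case by auto
next
  case (Suc n)
  then obtain A where A: "A \<subseteq> {0..}" "finite A" "card A = n" "AP_free k A" by blast
  have "AP_free k {0}" using k by (intro AP_free_singleton) simp
  then obtain C where "C \<subseteq> {0..}" "finite C" "card C = card A + card {0::int}" "AP_free k C"
    using AP_free_join[OF A(1,2,4), of "{0}" 1] k by auto
  then show ?case using A(3) by auto
qed

section \<open>The extremal count \<open>max_AP_count\<close> and its superadditivity\<close>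

lemma finite_AP_counts:
  "finite {AP_count s A |A. A \<subseteq> {0..} \<and> finite A \<and> card A = n \<and> AP_free k A}"
  by (rule finite_subset[of _ "{..2 ^ n}"]) (use AP_count_le_power in auto)

lemma AP_count_le_max:
  assumes "A \<subseteq> {0..}" "finite A" "card A = n" "AP_free k A"
  shows "AP_count s A \<le> max_AP_count s k n"
  unfolding max_AP_count_def by (rule Max_ge[OF finite_AP_counts]) (use assms in blast)

lemma max_AP_count_attained:
  assumes "k \<ge> 3"
  obtains A where "A \<subseteq> {0..}" "finite A" "card A = n" "AP_free k A" "AP_count s A = max_AP_count s k n"
proof -
  have "max_AP_count s k n \<in> {AP_count s A |A. A \<subseteq> {0..} \<and> finite A \<and> card A = n \<and> AP_free k A}"
    unfolding max_AP_count_def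
    by (rule Max_in[OF finite_AP_counts]) (use AP_free_exists[OF assms, of n] in blast)
  then obtain A where "max_AP_count s k n = AP_count s A" "A \<subseteq> {0..} \<and> finite A \<and> card A = n \<and> AP_free k A"
    by blast
  then show thesis using that[of A] by simp
qed

lemma max_AP_count_superadditive:
  assumes "k \<ge> 3" "s > 0"
  shows "max_AP_count s k a + max_AP_count s k b \<le> max_AP_count s k (a + b)"
proof -
  obtain A where A: "A \<subseteq> {0..}" "finite A" "card A = a" "AP_free k A" "AP_count s A = max_AP_count s k a"
    using max_AP_count_attained[OF assms(1)] .
  obtain B where B: "B \<subseteq> {0..}" "finite B" "card B = b" "AP_free k B" "AP_count s B = max_AP_count s k b"
    using max_AP_count_attained[OF assms(1)] .
  obtain C where C: "C \<subseteq> {0..}" "finite C" "card C = card A + card B" "AP_free k C"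
    "AP_count s A + AP_count s B \<le> AP_count s C"
    using AP_free_join[OF A(1,2,4) B(1,2,4) assms] .
  have "AP_count s C \<le> max_AP_count s k (a + b)" using C A B by (intro AP_count_le_max) auto
  then show ?thesis using C A B by simp
qed

lemma max_AP_count_mono:
  assumes "k \<ge> 3" "s > 0" "a \<le> b"
  shows "max_AP_count s k a \<le> max_AP_count s k b"
  using max_AP_count_superadditive[OF assms(1,2), of a "b - a"] assms(3) by simp

lemma max_AP_count_mult:
  assumes "k \<ge> 3" "s > 0"
  shows "j * max_AP_count s k a \<le> max_AP_count s k (j * a)"
proof (induction j)
  case (Suc j)
  have "Suc j * max_AP_count s k a \<le> max_AP_count s k a + max_AP_count s k (j * a)" using Suc by simp
  also have "\<dots> \<le> max_AP_count s k (a + j * a)" using assms by (rule max_AP_count_superadditive)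
  finally show ?case by simp
qed simp

section \<open>Progressions running across equidistant windows\<close>

lemma inj_on_increasing_AP:
  assumes "s \<ge> 2"
  shows "inj_on (\<lambda>(x, d). (\<lambda>i. x + int i * d) ` {..<s}) {(x, d). d > 0}"
proof (rule inj_onI)
  fix p q :: "int \<times> int"
  assume "p \<in> {(x, d). d > 0}" "q \<in> {(x, d). d > 0}"
    and "(\<lambda>(x, d). (\<lambda>i. x + int i * d) ` {..<s}) p = (\<lambda>(x, d). (\<lambda>i. x + int i * d) ` {..<s}) q"
  then obtain x d y e where pq: "p = (x, d)" "q = (y, e)" and de: "d > 0" "e > 0"
    and eq: "(\<lambda>i. x + int i * d) ` {..<s} = (\<lambda>i. y + int i * e) ` {..<s}" by auto
  \<comment> \<open>One inclusion gives one inequality: the start of the first progression is a term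
    of the second, and with equal starts so is its next term. Exchanging the roles gives
    equality.\<close>
  have le: "v \<le> u" "u = v \<Longrightarrow> f \<le> c"
    if "c > 0" "f > 0" "(\<lambda>i. u + int i * c) ` {..<s} = (\<lambda>i. v + int i * f) ` {..<s}" for u v c f
  proof -
    have mem: "u + int i * c \<in> (\<lambda>i. v + int i * f) ` {..<s}" if "i < s" for i
      using that \<open>(\<lambda>i. u + int i * c) ` {..<s} = _\<close> by blast
    obtain i where "u + int 0 * c = v + int i * f" using mem[of 0] assms by auto
    moreover have "int i * f \<ge> 0" using that(2) by simp
    ultimately show "v \<le> u" by simp
    assume "u = v"
    moreover obtain i where "u + int 1 * c = v + int i * f" using mem[of 1] assms by auto
    ultimately have i: "c = int i * f" by simp
    then have "i \<ge> 1" using that(1) by (cases i) auto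
    then have "1 * f \<le> int i * f" using that(2) by (intro mult_right_mono) auto
    then show "f \<le> c" using i by simp
  qed
  have "x = y" using le(1)[OF de eq] le(1)[OF de(2,1) eq[symmetric]] by simp
  moreover from this have "d = e" using le(2)[OF de eq] le(2)[OF de(2,1) eq[symmetric]] by simp
  ultimately show "p = q" using pq by simp
qed

text \<open>Offsets inside windows lie in \<open>[0, W/2)\<close>, so their second differences are
  smaller than \<open>W\<close> in absolute value. Hence the window indices have second difference
  zero, and a progression never leaves its window.\<close>

lemma AP_free_fibres:
  fixes t :: "nat \<Rightarrow> int"
  assumes S: "AP_free k S" and sk: "s < k"
    and h: "\<And>i a. i < s \<Longrightarrow> a \<in> S \<Longrightarrow> 0 \<le> t i + a \<and> 2 * (t i + a) < W"
  shows "AP_free k (\<Union>i<s. (\<lambda>a. int i * W + t i + a) ` S)"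
proof (rule AP_freeI, rule ccontr)
  let ?A = "\<Union>i<s. (\<lambda>a. int i * W + t i + a) ` S"
  fix x d :: int assume d: "d > 0" and "\<not> (\<exists>j<k. x + int j * d \<notin> ?A)"
  then have "\<forall>j. \<exists>i a. j < k \<longrightarrow> i < s \<and> a \<in> S \<and> x + int j * d = int i * W + t i + a" by force
  then obtain \<iota> \<alpha> where *: "\<And>j. j < k \<Longrightarrow> \<iota> j < s" "\<And>j. j < k \<Longrightarrow> \<alpha> j \<in> S"
    "\<And>j. j < k \<Longrightarrow> x + int j * d = int (\<iota> j) * W + t (\<iota> j) + \<alpha> j"
    by metis
  define r where "r j = t (\<iota> j) + \<alpha> j" for j
  have r: "0 \<le> r j" "2 * r j < W" if "j < k" for j using h[OF *(1)[OF that] *(2)[OF that]] by (auto simp: r_def)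
  have W: "W > 0" using r[of 0] sk by linarith
  have "int (\<iota> j) + int (\<iota> (j + 2)) = 2 * int (\<iota> (j + 1))" if "j + 2 < k" for j
  proof -
    define u where "u = int (\<iota> j) + int (\<iota> (j + 2)) - 2 * int (\<iota> (j + 1))"
    have "u * W = 2 * r (j + 1) - r j - r (j + 2)"
      using *(3)[of j] *(3)[of "j + 1"] *(3)[of "j + 2"] that by (simp add: u_def r_def algebra_simps)
    then have "\<bar>u * W\<bar> < W" using r[of j] r[of "j + 1"] r[of "j + 2"] that by linarith
    then have "\<bar>u\<bar> * W < 1 * W" using W by (simp add: abs_mult)
    then have "\<bar>u\<bar> < 1" using W by (simp only: mult_less_cancel_right)
    then show ?thesis by (simp add: u_def)
  qed
  then have lin: "int (\<iota> j) = int (\<iota> 0) + int j * (int (\<iota> 1) - int (\<iota> 0))" if "j < k" for j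
    using second_difference_zero[of k "\<lambda>j. int (\<iota> j)" j] that by simp
  \<comment> \<open>A nonzero index step would move the index by at least
    \<open>k - 1 \<ge> s\<close> in total, but only \<open>s\<close> indices exist.\<close>
  have "\<iota> 1 = \<iota> 0"
  proof (rule ccontr)
    assume "\<iota> 1 \<noteq> \<iota> 0"
    then have "1 \<le> \<bar>int (\<iota> 1) - int (\<iota> 0)\<bar>" by simp
    then have "int (k - 1) * 1 \<le> int (k - 1) * \<bar>int (\<iota> 1) - int (\<iota> 0)\<bar>" by (rule mult_left_mono) simp
    also have "\<dots> = \<bar>int (\<iota> (k - 1)) - int (\<iota> 0)\<bar>" using lin[of "k - 1"] sk by (simp add: abs_mult)
    also have "\<dots> < int s" using *(1)[of 0] *(1)[of "k - 1"] sk by linarith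
    finally show False using sk by linarith
  qed
  then have const: "\<iota> j = \<iota> 0" if "j < k" for j using lin[OF that] by simp
  have "(x - int (\<iota> 0) * W - t (\<iota> 0)) + int j * d \<in> S" if "j < k" for j
  proof -
    have "(x - int (\<iota> 0) * W - t (\<iota> 0)) + int j * d = \<alpha> j"
      using *(3)[OF that] unfolding const[OF that] by linarith
    then show ?thesis using *(2)[OF that] by simp
  qed
  then show False using S d unfolding AP_free_iff by (metis less_irrefl)
qed

text \<open>Average over \<open>t\<close>: for fixed \<open>(y, d)\<close>, exactly \<open>card S\<close> of the \<open>3 m\<close> values of each \<open>t i\<close> are good.\<close>

lemma exists_shifts:
  assumes S: "S \<subseteq> {1..int m}" and m: "m > 0" and s: "s > 0"
  obtains t :: "nat \<Rightarrow> int" where "\<forall>i<s. t i \<in> {0..<3 * int m}"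
    "m * (m div s + 1) * card S ^ s \<le>
       card {(y, d) \<in> {int m + 1..2 * int m} \<times> {0..int (m div s)}. \<forall>i<s. y + int i * d - t i \<in> S} * (3 * m) ^ s"
proof -
  \<comment> \<open>For \<open>i < s\<close> these ranges give \<open>0 \<le> i * d \<le> m\<close>;
    with \<open>m < y \<le> 2 * m\<close> and \<open>1 \<le> a \<le> m\<close>, the shift
    \<open>y + i * d - a\<close> falls in \<open>{0..<3 * m}\<close>.\<close>
  define Y where "Y = {int m + 1..2 * int m} \<times> {0..int (m div s)}"
  define T where "T = (\<Pi>\<^sub>E i\<in>{..<s}. {0..<3 * int m})"
  define good where "good g t \<longleftrightarrow> (\<forall>i<s. fst g + int i * snd g - t i \<in> S)" for g t
  have finY: "finite Y" and finT: "finite T" by (auto simp: Y_def T_def intro: finite_PiE)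
  have cY: "card Y = m * (m div s + 1)" by (simp add: Y_def card_cartesian_product nat_add_distrib)
  have cT: "card T = (3 * m) ^ s" by (simp add: T_def card_PiE nat_mult_distrib)
  have many: "card S ^ s \<le> card {t \<in> T. good g t}" if g: "g \<in> Y" for g
  proof -
    obtain y d where yd: "g = (y, d)" by (cases g)
    \<comment> \<open>For each \<open>i\<close> every \<open>a\<close> in \<open>S\<close> fixes one
      shift with \<open>y + i * d - t i = a\<close>, independently of the other coordinates.\<close>
    define F where "F = (\<Pi>\<^sub>E i\<in>{..<s}. (\<lambda>a. y + int i * d - a) ` S)"
    have "card ((\<lambda>a. y + int i * d - a) ` S) = card S" for i
      by (rule card_image) (auto intro: inj_onI)
    then have "card F = card S ^ s" unfolding F_def by (simp add: card_PiE)
    moreover have "F \<subseteq> {t \<in> T. good g t}"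
    proof
      fix t assume t: "t \<in> F"
      have ti: "t i \<in> {0..<3 * int m} \<and> y + int i * d - t i \<in> S" if i: "i < s" for i
      proof -
        obtain a where a: "a \<in> S" "t i = y + int i * d - a" using t i unfolding F_def by blast
        have "int i * d \<le> int s * int (m div s)" using i g yd by (intro mult_mono) (auto simp: Y_def)
        also have "\<dots> \<le> int m" by (simp flip: of_nat_mult)
        finally have "int i * d \<le> int m" .
        moreover have "0 \<le> int i * d" using g yd by (simp add: Y_def)
        moreover have "1 \<le> a" "a \<le> int m" using a S by auto
        moreover have "int m + 1 \<le> y" "y \<le> 2 * int m" using g yd by (auto simp: Y_def)
        ultimately have "0 \<le> t i" "t i < 3 * int m" using a(2) by linarith+
        then show ?thesis using a by simp
      qed
      moreover have "t \<in> extensional {..<s}" using t by (simp add: F_def PiE_def)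
      ultimately show "t \<in> {t \<in> T. good g t}"
        unfolding T_def good_def yd by (auto simp: PiE_def)
    qed
    moreover have "finite {t \<in> T. good g t}" using finT by simp
    ultimately show ?thesis using card_mono by metis
  qed
  have "\<exists>t\<in>T. card Y * card S ^ s \<le> card {g \<in> Y. good g t} * card T"
  proof (rule ccontr)
    assume "\<not> ?thesis"
    then have less: "card {g \<in> Y. good g t} * card T < card Y * card S ^ s" if "t \<in> T" for t
      using that by auto
    have "card T > 0" using m by (simp add: cT)
    then have "T \<noteq> {}" by auto
    then have "(\<Sum>t\<in>T. card {g \<in> Y. good g t} * card T) < (\<Sum>t\<in>T. card Y * card S ^ s)"
      using finT less by (intro sum_strict_mono) auto
    then have "(\<Sum>t\<in>T. card {g \<in> Y. good g t}) * card T < (card Y * card S ^ s) * card T"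
      unfolding sum_distrib_right[symmetric] sum_constant by (simp only: of_nat_id mult_ac)
    then have "(\<Sum>t\<in>T. card {g \<in> Y. good g t}) < card Y * card S ^ s" by simp
    also have "\<dots> = (\<Sum>g\<in>Y. card S ^ s)" by simp
    also have "\<dots> \<le> (\<Sum>g\<in>Y. card {t \<in> T. good g t})" by (intro sum_mono many)
    also have "\<dots> = (\<Sum>t\<in>T. card {g \<in> Y. good g t})" by (rule sum_card_swap[OF finY finT])
    finally show False by simp
  qed
  then obtain t where t: "t \<in> T" "card Y * card S ^ s \<le> card {g \<in> Y. good g t} * card T" by blast
  show thesis
  proof (rule that[of t])
    show "\<forall>i<s. t i \<in> {0..<3 * int m}" using t(1) unfolding T_def by blast
    have "{g \<in> Y. good g t} = {(y, d) \<in> {int m + 1..2 * int m} \<times> {0..int (m div s)}. \<forall>i<s. y + int i * d - t i \<in> S}"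
      by (auto simp: Y_def good_def)
    then show "m * (m div s + 1) * card S ^ s \<le>
       card {(y, d) \<in> {int m + 1..2 * int m} \<times> {0..int (m div s)}. \<forall>i<s. y + int i * d - t i \<in> S} * (3 * m) ^ s"
      using t(2) by (simp add: cY cT)
  qed
qed

text \<open>Each good pair \<open>(y, d)\<close> yields the progression with start \<open>y\<close>
  and step \<open>d + W\<close>, whose \<open>i\<close>-th term lies in the \<open>i\<close>-th
  translate of \<open>S\<close>; distinct pairs yield distinct progressions.\<close>

lemma fibre_construction:
  assumes s: "s \<ge> 2" and sk: "s < k" and m: "m > 0"
  obtains A where "A \<subseteq> {0..}" "finite A" "card A \<le> s * r_AP k m" "AP_free k A"
    "m * (m div s + 1) * r_AP k m ^ s \<le> AP_count s A * (3 * m) ^ s"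
proof -
  have "k > 0" using sk by simp
  then obtain S where S: "S \<subseteq> {1..int m}" "AP_free k S" "card S = r_AP k m" by (rule r_AP_attained)
  have "s > 0" using s by simp
  then obtain t :: "nat \<Rightarrow> int" where t: "\<forall>i<s. t i \<in> {0..<3 * int m}"
    and many: "m * (m div s + 1) * card S ^ s \<le>
       card {(y, d) \<in> {int m + 1..2 * int m} \<times> {0..int (m div s)}. \<forall>i<s. y + int i * d - t i \<in> S} * (3 * m) ^ s"
    by (rule exists_shifts[OF S(1) m])
  define G where "G = {(y, d) \<in> {int m + 1..2 * int m} \<times> {0..int (m div s)}. \<forall>i<s. y + int i * d - t i \<in> S}"
  \<comment> \<open>Offsets \<open>t i + a\<close> are below \<open>4 * m\<close>, so twice an
    offset stays below \<open>W\<close>.\<close>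
  define W where "W = 8 * int m"
  define A where "A = (\<Union>i<s. (\<lambda>a. int i * W + t i + a) ` S)"
  have finS: "finite S" using S(1) finite_subset by blast
  have range: "0 \<le> t i + a \<and> 2 * (t i + a) < W" if "i < s" "a \<in> S" for i a
  proof -
    have "0 \<le> t i" "t i < 3 * int m" using t that(1) by auto
    moreover have "1 \<le> a" "a \<le> int m" using S(1) that(2) by auto
    ultimately have "0 \<le> t i + a" "t i + a < 4 * int m" by linarith+
    then show ?thesis unfolding W_def by simp
  qed
  show thesis
  proof (rule that[of A])
    show "A \<subseteq> {0..}"
    proof
      fix x assume "x \<in> A"
      then obtain i a where ia: "i < s" "a \<in> S" "x = int i * W + t i + a" by (auto simp: A_def)
      have "int i * W \<ge> 0" by (simp add: W_def)
      then have "x \<ge> 0" using range[OF ia(1,2)] ia(3) by linarith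
      then show "x \<in> {0..}" by simp
    qed
    show "finite A" using finS by (simp add: A_def)
    show "AP_free k A" unfolding A_def using S(2) sk range by (rule AP_free_fibres)
    have "card A \<le> (\<Sum>i<s. card ((\<lambda>a. int i * W + t i + a) ` S))" unfolding A_def by (rule card_UN_le) simp
    also have "\<dots> \<le> (\<Sum>i<s. card S)" using finS by (intro sum_mono card_image_le)
    finally show "card A \<le> s * r_AP k m" using S(3) by simp
    have "card G \<le> AP_count s A"
      unfolding AP_count_def
    proof (rule card_inj_on_le)
      let ?f = "\<lambda>(x, d). (\<lambda>i. x + int i * d) ` {..<s}"
      let ?g = "\<lambda>(y, d). (y, d + W)"
      have "?g ` G \<subseteq> {(x, d). d > 0}" using m by (auto simp: G_def W_def)
      moreover have "inj_on ?g G" by (auto intro: inj_onI)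
      ultimately show "inj_on (?f \<circ> ?g) G"
        using inj_on_subset[OF inj_on_increasing_AP[OF s]] by (intro comp_inj_on) auto
      show "(?f \<circ> ?g) ` G \<subseteq> {P. is_AP s P \<and> P \<subseteq> A}"
      proof
        fix P assume "P \<in> (?f \<circ> ?g) ` G"
        then obtain y d where yd: "(y, d) \<in> G" and P: "P = (\<lambda>i. y + int i * (d + W)) ` {..<s}" by auto
        have "d + W \<noteq> 0" using yd m by (auto simp: G_def W_def)
        then have "is_AP s P" unfolding is_AP_def P by blast
        moreover have "y + int i * (d + W) \<in> A" if "i < s" for i
        proof -
          have "y + int i * d - t i \<in> S" using yd that by (auto simp: G_def)
          moreover have "y + int i * (d + W) = int i * W + t i + (y + int i * d - t i)"
            by (simp add: algebra_simps)
          ultimately show ?thesis unfolding A_def using that by blast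
        qed
        ultimately show "P \<in> {P. is_AP s P \<and> P \<subseteq> A}" unfolding P by blast
      qed
      show "finite {P. is_AP s P \<and> P \<subseteq> A}" using finS by (intro finite_APs) (simp add: A_def)
    qed
    then have "card G * (3 * m) ^ s \<le> AP_count s A * (3 * m) ^ s" by simp
    then show "m * (m div s + 1) * r_AP k m ^ s \<le> AP_count s A * (3 * m) ^ s"
      using many unfolding G_def S(3) by (rule order_trans[rotated])
  qed
qed

text \<open>This is the total constant loss of the lower bound, to be absorbed by the base 1/1000.
  Since \<open>s + 1 \<le> 2 * s\<close>, one step costs at most 8 * 3 * 2 = 48.\<close>

lemma cubic_exponential_le_power_1000:
  assumes "s \<ge> (3::nat)"
  shows "4 * s ^ 3 * 3 ^ s * 2 ^ (s - 1) \<le> (1000::nat) ^ (2 * (s - 2))"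
  using assms
proof (induction s rule: dec_induct)
  case base
  then show ?case by simp
next
  case (step s)
  have double: "2 ^ (Suc s - 1) = 2 * (2::nat) ^ (s - 1)" using step by (cases s) auto
  have "Suc s ^ 3 \<le> (2 * s) ^ 3" using step by (intro power_mono) auto
  then have "4 * Suc s ^ 3 * 3 ^ Suc s * 2 ^ (Suc s - 1) \<le> 4 * (2 * s) ^ 3 * 3 ^ Suc s * 2 ^ (Suc s - 1)"
    by (intro mult_right_mono mult_left_mono) auto
  also have "\<dots> = 48 * (4 * s ^ 3 * 3 ^ s * 2 ^ (s - 1))"
    unfolding double by (simp add: power_mult_distrib)
  also have "\<dots> \<le> 1000 ^ 2 * 1000 ^ (2 * (s - 2))" using step.IH by (intro mult_mono) auto
  also have "\<dots> = 1000 ^ (2 * (Suc s - 2))"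
  proof -
    have "2 * (Suc s - 2) = 2 + 2 * (s - 2)" using step by auto
    then show ?thesis by (simp only: power_add)
  qed
  finally show ?case .
qed

lemma max_AP_count_lower_bound:
  assumes s: "s \<ge> 3" and sk: "s < k" and n: "n \<ge> s"
  shows "((1 / 1000) * r_AP k n / n) ^ (2 * (s - 2)) * real n ^ 2 \<le> max_AP_count s k n"
proof -
  define m where "m = n div s"
  define r where "r = r_AP k m"
  define \<rho> where "\<rho> = real r / m"
  define \<alpha> where "\<alpha> = real (r_AP k n) / n"
  have k: "k \<ge> 3" "k \<ge> 2" "k > 0" and s0: "s > 0" "s \<ge> 2" using s sk by auto
  have m: "m > 0" using n s0 by (simp add: m_def div_greater_zero_iff)
  have n0: "n > 0" using n s0 by simp
  have r: "r > 0" unfolding r_def using k m by (intro r_AP_pos) auto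
  have rm: "r \<le> m" unfolding r_def using k by (intro r_AP_le)
  have "s * m \<le> n" by (simp add: m_def)
  have mn: "n \<le> 2 * s * m"
  proof -
    have "n < s * m + s" unfolding m_def using dividend_less_times_div[OF s0(1), of n] by linarith
    also have "\<dots> \<le> s * m + s * m" using m by simp
    finally show ?thesis by simp
  qed
  obtain A where A: "A \<subseteq> {0..}" "finite A" "card A \<le> s * r" "AP_free k A"
    and cnt: "m * (m div s + 1) * r ^ s \<le> AP_count s A * (3 * m) ^ s"
    using fibre_construction[OF s0(2) sk m] unfolding r_def by blast
  define J where "J = n div (s * r)"
  have "J * AP_count s A \<le> J * max_AP_count s k (s * r)"
    using AP_count_le_max[OF A(1,2) refl A(4), of s] max_AP_count_mono[OF k(1) s0(1) A(3)]
    by (meson le_trans mult_le_mono2)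
  also have "\<dots> \<le> max_AP_count s k (J * (s * r))" using k s0 by (intro max_AP_count_mult)
  also have "\<dots> \<le> max_AP_count s k n" using k s0 by (intro max_AP_count_mono) (auto simp: J_def)
  finally have "real J * AP_count s A \<le> max_AP_count s k n" by (metis of_nat_le_iff of_nat_mult)
  \<comment> \<open>As \<open>J \<ge> 1\<close>, rounding down loses at most a factor 2.\<close>
  moreover have "n / (2 * s * r) \<le> J"
  proof -
    have "s * r \<le> n" using rm \<open>s * m \<le> n\<close> by (meson le_trans mult_le_mono2)
    then have "J \<ge> 1" using s0 r by (simp add: J_def div_greater_zero_iff Suc_le_eq)
    have "n < s * r * J + s * r" unfolding J_def using dividend_less_times_div[of "s * r" n] s0 r by simp
    also have "\<dots> \<le> s * r * J + s * r * J" using \<open>J \<ge> 1\<close> by simp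
    finally have "n \<le> J * (2 * s * r)" by (simp add: mult_ac)
    then have "real n \<le> real J * (2 * s * r)" by (metis of_nat_le_iff of_nat_mult of_nat_numeral)
    then show ?thesis using s0 r by (simp add: divide_le_eq)
  qed
  moreover have "m\<^sup>2 / s * (\<rho> / 3) ^ s \<le> AP_count s A"
  proof -
    have "m < s * (m div s) + s" using dividend_less_times_div[OF s0(1), of m] by linarith
    then have "m \<le> s * (m div s + 1)" by simp
    then have "real m \<le> real s * (m div s + 1)" by (metis of_nat_le_iff of_nat_mult)
    then have "real m / s \<le> m div s + 1" using s0 by (simp add: divide_le_eq mult.commute)
    then have "real m * (real m / s) * real r ^ s \<le> real m * (m div s + 1) * real r ^ s"
      by (intro mult_right_mono mult_left_mono) auto
    also have "\<dots> \<le> real (AP_count s A) * (3 * real m) ^ s"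
      using of_nat_mono[OF cnt, where 'a = real] by (simp add: ring_distribs)
    finally have le: "real m * (real m / s) * real r ^ s \<le> real (AP_count s A) * (3 * real m) ^ s" .
    have "real m * (real m / s) * (real r / (3 * m)) ^ s \<le> AP_count s A"
    proof -
      have "(3 * real m) ^ s > 0" using m by simp
      then have "real m * (real m / s) * real r ^ s / (3 * real m) ^ s \<le> AP_count s A"
        using le by (simp only: pos_divide_le_eq)
      then show ?thesis by (simp only: power_divide times_divide_eq_right of_nat_mult of_nat_numeral)
    qed
    then show ?thesis by (simp add: \<rho>_def power2_eq_square mult_ac)
  qed
  ultimately have 1: "n / (2 * s * r) * (m\<^sup>2 / s * (\<rho> / 3) ^ s) \<le> max_AP_count s k n"
    by (smt (verit) mult_mono of_nat_0_le_iff \<rho>_def divide_nonneg_nonneg mult_nonneg_nonneg zero_le_power)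
  have \<rho>0: "\<rho> > 0" using r m by (simp add: \<rho>_def)
  \<comment> \<open>The number of copies is inversely proportional to \<open>r\<close>, which
    cancels one of the \<open>s\<close> factors \<open>\<rho>\<close>.\<close>
  have "n / (2 * s * r) * (m\<^sup>2 / s * (\<rho> / 3) ^ s) = real n * m * \<rho> ^ (s - 1) / (2 * s\<^sup>2 * 3 ^ s)"
  proof -
    have "\<rho> ^ s = \<rho> * \<rho> ^ (s - 1)" using s0 by (metis power_minus_mult mult.commute)
    then show ?thesis using r m s0 by (simp add: \<rho>_def power2_eq_square power_divide field_simps)
  qed
  moreover have "real n * (n / (2 * s)) * \<rho> ^ (s - 1) / (2 * s\<^sup>2 * 3 ^ s) \<le> real n * m * \<rho> ^ (s - 1) / (2 * s\<^sup>2 * 3 ^ s)"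
  proof -
    have "real n \<le> real (2 * s * m)" using mn by (rule of_nat_mono)
    then have "n / (2 * s) \<le> m" using s0 by (simp add: divide_le_eq mult_ac)
    then show ?thesis using \<rho>0 by (intro divide_right_mono mult_right_mono mult_left_mono) auto
  qed
  moreover have "real n * (n / (2 * s)) * \<rho> ^ (s - 1) / (2 * s\<^sup>2 * 3 ^ s) = \<rho> ^ (s - 1) / (4 * s ^ 3 * 3 ^ s) * real n ^ 2"
    by (simp add: power2_eq_square power3_eq_cube mult_ac)
  ultimately have 2: "\<rho> ^ (s - 1) / (4 * s ^ 3 * 3 ^ s) * real n ^ 2 \<le> max_AP_count s k n"
    using 1 by linarith
  have \<alpha>0: "0 \<le> \<alpha>" by (simp add: \<alpha>_def)
  have \<alpha>1: "\<alpha> \<le> 1" using r_AP_le[OF k(3), of n] n0 by (simp add: \<alpha>_def)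
  \<comment> \<open>Density at the smaller scale \<open>m\<close> is at least half of that at
    \<open>n\<close>, since \<open>n div m + 1 \<le> 2 * n / m\<close>.\<close>
  have "\<alpha> / 2 \<le> \<rho>"
  proof -
    have "real (r_AP k n) \<le> real ((n div m + 1) * r)"
      unfolding r_def using r_AP_subadditive[OF k(3) m, of n] by (rule of_nat_mono)
    also have "\<dots> = real (n div m + 1) * r" by (simp only: of_nat_mult)
    also have "\<dots> \<le> (n / m + 1) * r" using of_nat_div_le_of_nat[of n m, where 'a = real]
      by (intro mult_right_mono) auto
    also have "\<dots> \<le> (n / m + n / m) * r"
    proof -
      have "m \<le> n" by (simp add: m_def)
      then show ?thesis using m by (intro mult_right_mono add_left_mono) auto
    qed
    finally show ?thesis using n0 by (simp add: \<alpha>_def \<rho>_def field_simps)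
  qed
  then have "(\<alpha> / 2) ^ (s - 1) \<le> \<rho> ^ (s - 1)" using \<alpha>0 by (intro power_mono) auto
  then have 3: "(\<alpha> / 2) ^ (s - 1) / (4 * s ^ 3 * 3 ^ s) \<le> \<rho> ^ (s - 1) / (4 * s ^ 3 * 3 ^ s)"
    by (intro divide_right_mono) auto
  have "((1 / 1000) * \<alpha>) ^ (2 * (s - 2)) = \<alpha> ^ (2 * (s - 2)) / 1000 ^ (2 * (s - 2))"
    by (simp add: power_divide)
  \<comment> \<open>For \<open>s \<ge> 3\<close> the exponent \<open>s - 1\<close> is at most
    \<open>2 * (s - 2)\<close>, and \<open>\<alpha> \<le> 1\<close>.\<close>
  also have "\<dots> \<le> \<alpha> ^ (s - 1) / 1000 ^ (2 * (s - 2))"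
    using s \<alpha>0 \<alpha>1 by (intro divide_right_mono power_decreasing) auto
  also have "\<dots> \<le> \<alpha> ^ (s - 1) / (4 * s ^ 3 * 3 ^ s * 2 ^ (s - 1))"
    using of_nat_mono[OF cubic_exponential_le_power_1000[OF s], where 'a = real] \<alpha>0 s0 by (intro divide_left_mono) auto
  also have "\<dots> = (\<alpha> / 2) ^ (s - 1) / (4 * s ^ 3 * 3 ^ s)" by (simp add: power_divide)
  also note 3
  finally have "((1 / 1000) * \<alpha>) ^ (2 * (s - 2)) * real n ^ 2 \<le> \<rho> ^ (s - 1) / (4 * s ^ 3 * 3 ^ s) * real n ^ 2"
    by (rule mult_right_mono) simp
  then show ?thesis using 2 by (simp add: \<alpha>_def)
qed

theorem theorem2:
  "\<exists>c C :: real. c > 0 \<and> C > 0 \<and>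
     (\<forall>s k :: nat. 3 \<le> s \<and> s < k \<longrightarrow>
       (\<forall>\<^sub>F n :: nat in sequentially.
          (c * real (r_AP k n) / real n) ^ (2 * (s - 2)) * real n ^ 2 \<le> real (max_AP_count s k n) \<and>
          real (max_AP_count s k n) \<le> (real (r_AP k n) / real n) powr C * real n ^ 2))"
proof (intro exI conjI allI impI)
  fix s k :: nat assume sk: "3 \<le> s \<and> s < k"
  \<comment> \<open>The constants are 1/1000 and 1/87, and sufficiently large means
    \<open>n \<ge> s\<close>.\<close>
  show "\<forall>\<^sub>F n :: nat in sequentially.
          (1 / 1000 * real (r_AP k n) / real n) ^ (2 * (s - 2)) * real n ^ 2 \<le> real (max_AP_count s k n) \<and>
          real (max_AP_count s k n) \<le> (real (r_AP k n) / real n) powr (1 / 87) * real n ^ 2"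
    using eventually_ge_at_top[of s]
  proof eventually_elim
    case (elim n)
    have "k \<ge> 3" using sk by simp
    then obtain A where "A \<subseteq> {0..}" "finite A" "card A = n" "AP_free k A" "AP_count s A = max_AP_count s k n"
      by (rule max_AP_count_attained)
    then show ?case
      using max_AP_count_lower_bound[of s k n] AP_count_upper_bound[of A n k s] sk elim by auto
  qed
qed auto

end
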